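(* Let $n\ge1$ and let $r$ be an even integer with $0\le r\le n-1$. For $T>0$ let $N_{n,r}(T)=\#\{A\in\mathrm{M}_n(\mathbb{Z})_{\mathrm{alt}}:\ \operatorname{rank}A=r,\ |A|<T\}$, where $|A|=(\sum_{i,j}a_{ij}^2)^{1/2}$. Then $N_{n,r}(T)\ll_n T^{nr/2}$ for all sufficiently large real $T$.
   Context: $\mathrm{M}_n(\mathbb{Z})_{\mathrm{alt}}$ is the set of $n\times n$ integer matrices $A$ with $A^T=-A$ and zero diagonal. $f\ll_n g$ means $f\le C(n)g$ for a positive constant $C(n)$ depending only on $n$. *)

theory Defs
  imports "HOL-Analysis.Analysis"
begin

definition alternating_matrix :: "int^'n^'n \<Rightarrow> bool" where
  "alternating_matrix A \<longleftrightarrow> transpose A = - A \<and> (\<forall>i. A $ i $ i = 0)"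

definition frobenius_norm :: "int^'n^'n \<Rightarrow> real" where
  "frobenius_norm A = sqrt (\<Sum>i\<in>UNIV. \<Sum>j\<in>UNIV. (real_of_int (A $ i $ j))\<^sup>2)"

text \<open>The library's \<^const>\<open>rank\<close> needs a field of scalars, so an integer matrix is
  regarded as a real one; its rank over the rationals is the same.\<close>

definition alt_matrices_rank_less :: "nat \<Rightarrow> real \<Rightarrow> (int^'n^'n) set" where
  "alt_matrices_rank_less r T =
     {A. alternating_matrix A \<and> rank (map_matrix real_of_int A) = r \<and> frobenius_norm A < T}"

text \<open>Finiteness ensures that \<^const>\<open>card\<close> genuinely counts this set.\<close>

lemma finite_alt_matrices_rank_less:
  "finite (alt_matrices_rank_less r T :: (int^'n^'n) set)"
proof -
  let ?S = "{-\<lceil>T\<rceil>..\<lceil>T\<rceil>}"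
  let ?F = "{g :: 'n \<times> 'n \<Rightarrow> int. range g \<subseteq> ?S}"
  let ?m = "\<lambda>g :: 'n \<times> 'n \<Rightarrow> int. (\<chi> i j. g (i, j)) :: int^'n^'n"
  have "?F = (UNIV \<rightarrow>\<^sub>E ?S)"
    by (auto simp: PiE_def)
  then have "finite ?F"
    by (metis finite_PiE finite_atLeastAtMost_int finite)
  moreover have "alt_matrices_rank_less r T \<subseteq> ?m ` ?F"
  proof
    fix A :: "int^'n^'n"
    assume "A \<in> alt_matrices_rank_less r T"
    then have T: "frobenius_norm A < T"
      by (simp add: alt_matrices_rank_less_def)
    have bound: "A $ i $ j \<in> ?S" for i j
    proof -
      have "(real_of_int (A $ i $ j))\<^sup>2 \<le> (\<Sum>j\<in>UNIV. (real_of_int (A $ i $ j))\<^sup>2)"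
        by (rule member_le_sum) auto
      also have "\<dots> \<le> (\<Sum>i\<in>UNIV. \<Sum>j\<in>UNIV. (real_of_int (A $ i $ j))\<^sup>2)"
        by (rule member_le_sum[where f = "\<lambda>i. \<Sum>j\<in>UNIV. (real_of_int (A $ i $ j))\<^sup>2"])
          (auto intro: sum_nonneg)
      finally have "\<bar>real_of_int (A $ i $ j)\<bar> \<le> frobenius_norm A"
        unfolding frobenius_norm_def by (metis real_sqrt_abs real_sqrt_le_mono)
      with T have "\<bar>real_of_int (A $ i $ j)\<bar> < T"
        by simp
      then show ?thesis
        by (simp add: abs_less_iff) linarith
    qed
    have "A = ?m (\<lambda>p. A $ fst p $ snd p)"
      by (simp add: vec_eq_iff)
    moreover have "(\<lambda>p. A $ fst p $ snd p) \<in> ?F"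
      using bound by blast
    ultimately show "A \<in> ?m ` ?F"
      by (rule image_eqI)
  qed
  ultimately show ?thesis
    by (meson finite_imageI finite_subset)
qed

end

theory Submission
  imports Defs
begin

text \<open>
  An alternating integer matrix \<open>A\<close> of rank \<open>r\<close> has the form \<open>b\<^sup>T X b\<close>, where the rows
  of \<open>b\<close> are a reduced basis of the lattice of integer vectors in the range of \<open>A\<close> and \<open>X\<close> is
  an alternating nonsingular integer matrix. If the basis vectors have sizes
  \<open>B\<^sub>1 \<le> \<dots> \<le> B\<^sub>r\<close>, reducedness gives \<open>\<bar>X\<^sub>i\<^sub>j\<bar> \<lesssim> T / (B\<^sub>i B\<^sub>j)\<close>, and a nonzero term of
  the Leibniz expansion of \<open>det X\<close> gives \<open>\<Prod>B\<^sub>i \<lesssim> T\<^bsup>r/2\<^esup>\<close>. Each lattice has about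
  \<open>\<Prod>\<^bsub>i<j\<^esub> B\<^sub>j / B\<^sub>i\<close> bases of these sizes, so for given sizes there are at most about
  \<open>\<Prod>B\<^sub>i\<^sup>n \<cdot> \<Prod>\<^bsub>i<j\<^esub> (B\<^sub>i / B\<^sub>j) \<cdot> \<Prod>\<^bsub>i<j\<^esub> (1 + T / (B\<^sub>i B\<^sub>j))\<close> matrices. As \<open>r < n\<close>, this is
  \<open>\<lesssim> T\<^bsup>nr/2\<^esup> \<Prod>\<^sub>i min(t\<^sub>i, 1/t\<^sub>i)\<^bsup>1/2\<^esup>\<close> with \<open>t\<^sub>i = B\<^sub>i / T\<^bsup>1/2\<^esup>\<close>, which is summable over dyadic sizes.
\<close>

section \<open>Reduced bases\<close>

definition sup_norm :: "real^'n \<Rightarrow> real" where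
  "sup_norm v = Max (range (\<lambda>k. \<bar>v $ k\<bar>))"

lemma component_le_sup_norm: "\<bar>v $ k\<bar> \<le> sup_norm v"
  unfolding sup_norm_def by (rule Max_ge) auto

lemma sup_norm_attained: obtains p where "sup_norm v = \<bar>v $ p\<bar>"
proof -
  have "sup_norm v \<in> range (\<lambda>k. \<bar>v $ k\<bar>)"
    unfolding sup_norm_def by (rule Max_in) auto
  then show ?thesis using that by auto
qed

definition additive_subgroup :: "(real^'n) set \<Rightarrow> bool" where
  "additive_subgroup L \<longleftrightarrow> 0 \<in> L \<and> (\<forall>x\<in>L. \<forall>y\<in>L. x - y \<in> L)"

lemma additive_subgroup_diff: "additive_subgroup L \<Longrightarrow> x \<in> L \<Longrightarrow> y \<in> L \<Longrightarrow> x - y \<in> L"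
  by (auto simp: additive_subgroup_def)

lemma additive_subgroup_add:
  assumes "additive_subgroup L" "x \<in> L" "y \<in> L" shows "x + y \<in> L"
proof -
  have "0 - y \<in> L" using assms by (auto simp: additive_subgroup_def)
  then have "x - (0 - y) \<in> L" using assms additive_subgroup_diff by blast
  then show ?thesis by simp
qed

lemma additive_subgroup_scale_int:
  assumes L: "additive_subgroup L" and x: "x \<in> L"
  shows "real_of_int m *\<^sub>R x \<in> L"
proof (induction m rule: int_induct[where k = 0])
  case base
  then show ?case using L by (simp add: additive_subgroup_def)
next
  case (step1 i)
  have "real_of_int i *\<^sub>R x + x \<in> L" by (rule additive_subgroup_add[OF L step1(2) x])
  then show ?case by (simp add: scaleR_add_left)
next
  case (step2 i)
  have "real_of_int i *\<^sub>R x - x \<in> L" by (rule additive_subgroup_diff[OF L step2(2) x])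
  then show ?case by (simp add: scaleR_diff_left)
qed

lemma additive_subgroup_sum:
  assumes L: "additive_subgroup L" and "\<And>i. i \<in> I \<Longrightarrow> f i \<in> L"
  shows "sum f I \<in> L"
  using assms(2)
proof (induction I rule: infinite_finite_induct)
  case (insert x F)
  then show ?case by (simp add: additive_subgroup_add[OF L])
qed (use L in \<open>auto simp: additive_subgroup_def\<close>)

text \<open>The vectors \<open>c i\<close> are a dual basis. The size condition on them says that
  \<open>b i\<close>, of size about \<open>\<beta> i\<close>, cannot be shortened much by adding the other
  basis vectors.\<close>

definition reduced_basis ::
  "real \<Rightarrow> real \<Rightarrow> (real^'n) set \<Rightarrow> nat \<Rightarrow> (nat \<Rightarrow> real^'n) \<Rightarrow> (nat \<Rightarrow> real^'n) \<Rightarrow> (nat \<Rightarrow> real) \<Rightarrow> bool"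
  where
  "reduced_basis C d L r b c \<beta> \<longleftrightarrow>
     (\<forall>i<r. b i \<in> L) \<and>
     (\<forall>v\<in>L. \<exists>m::nat \<Rightarrow> int. v = (\<Sum>i<r. real_of_int (m i) *\<^sub>R b i)) \<and>
     (\<forall>i<r. \<forall>j<r. inner (c i) (b j) = (if i = j then 1 else 0)) \<and>
     (\<forall>i<r. d \<le> \<beta> i) \<and> (\<forall>i j. i \<le> j \<longrightarrow> j < r \<longrightarrow> \<beta> i \<le> \<beta> j) \<and>
     (\<forall>i<r. \<forall>k. \<bar>b i $ k\<bar> \<le> C * \<beta> i) \<and>
     (\<forall>i<r. (\<Sum>k\<in>UNIV. \<bar>c i $ k\<bar>) * \<beta> i \<le> C)"

text \<open>The common denominator \<open>N\<close> makes \<open>\<bar>N\<bar> * sup_norm v\<close>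
  a natural number on \<open>L\<close>, so a minimum exists by well-ordering.\<close>

lemma shortest_vector:
  fixes L :: "(real^'n) set"
  assumes N: "N \<noteq> 0" "\<And>v k. v \<in> L \<Longrightarrow> N * v $ k \<in> \<int>" and ex: "\<exists>v\<in>L. v \<noteq> 0"
  obtains b where "b \<in> L" "b \<noteq> 0" "\<And>v. v \<in> L \<Longrightarrow> v \<noteq> 0 \<Longrightarrow> sup_norm b \<le> sup_norm v"
proof -
  let ?f = "\<lambda>v. nat \<lfloor>\<bar>N\<bar> * sup_norm v\<rfloor>"
  from ex obtain w where "w \<in> L \<and> w \<noteq> 0" by auto
  from ex_has_least_nat[where P = "\<lambda>v. v \<in> L \<and> v \<noteq> 0" and m = ?f, OF this]
  obtain b where b: "b \<in> L" "b \<noteq> 0" and least: "\<And>v. v \<in> L \<Longrightarrow> v \<noteq> 0 \<Longrightarrow> ?f b \<le> ?f v"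
    by blast
  have int: "real (?f v) = \<bar>N\<bar> * sup_norm v" if "v \<in> L" for v
  proof -
    obtain p where p: "sup_norm v = \<bar>v $ p\<bar>" by (rule sup_norm_attained)
    have "\<bar>N * v $ p\<bar> \<in> \<int>" using N(2)[OF that] by simp
    then have "\<bar>N\<bar> * sup_norm v \<in> \<int>" by (simp add: p abs_mult)
    moreover have "0 \<le> \<bar>N\<bar> * sup_norm v" by (simp add: p)
    ultimately show ?thesis
      by (metis of_int_floor_cancel of_int_nonneg of_nat_nat of_int_of_nat_eq floor_of_int
          Ints_cases of_int_0_le_iff)
  qed
  show thesis
  proof
    fix v assume v: "v \<in> L" "v \<noteq> 0"
    have "\<bar>N\<bar> * sup_norm b \<le> \<bar>N\<bar> * sup_norm v"
      using least[OF v] int[OF v(1)] int[OF b(1)] by (metis of_nat_le_iff)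
    then show "sup_norm b \<le> sup_norm v" using N(1) by simp
  qed (use b in auto)
qed

text \<open>Induction as for a Hermite--Korkine--Zolotarev basis, but instead of projecting
  orthogonally to a shortest vector \<open>b0\<close> one eliminates the coordinate \<open>p\<close> at which
  \<open>b0\<close> attains its sup norm. This keeps the lattice rational and at most doubles norms.\<close>

lemma reduced_basis_exists:
  "\<exists>C\<ge>1. \<forall>S::'n::finite set. \<forall>L::(real^'n) set. \<forall>N d. card S \<le> s \<longrightarrow> additive_subgroup L \<longrightarrow> N \<noteq> 0 \<longrightarrow>
     (\<forall>v\<in>L. \<forall>k. N * v $ k \<in> \<int>) \<longrightarrow> (\<forall>v\<in>L. \<forall>k. k \<notin> S \<longrightarrow> v $ k = 0) \<longrightarrow> 0 < d \<longrightarrow>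
     (\<forall>v\<in>L. v \<noteq> 0 \<longrightarrow> d \<le> sup_norm v) \<longrightarrow>
     (\<exists>r b c \<beta>. r \<le> s \<and> reduced_basis C d L r b c \<beta>)"
proof (induction s)
  case 0
  have "\<exists>r b c \<beta>. r \<le> 0 \<and> reduced_basis 1 d L r b c \<beta>"
    if "card S \<le> 0" "\<forall>v\<in>L. \<forall>k. k \<notin> S \<longrightarrow> v $ k = 0" for S :: "'n set" and L :: "(real^'n) set" and d
  proof -
    have "S = {}" using that(1) by (simp add: card_eq_0_iff)
    then have "\<forall>v\<in>L. v = 0" using that(2) by (auto simp: vec_eq_iff)
    then show ?thesis by (intro exI[of _ 0]) (simp add: reduced_basis_def)
  qed
  then show ?case by (intro exI[of _ 1]) auto
next
  case (Suc s)
  then obtain C where C: "C \<ge> 1" and IH: "\<And>(S::'n set) (L::(real^'n) set) N d. card S \<le> s \<Longrightarrow> additive_subgroup L \<Longrightarrow> N \<noteq> 0 \<Longrightarrow>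
     (\<forall>v\<in>L. \<forall>k. N * v $ k \<in> \<int>) \<Longrightarrow> (\<forall>v\<in>L. \<forall>k. k \<notin> S \<longrightarrow> v $ k = 0) \<Longrightarrow> 0 < d \<Longrightarrow>
     (\<forall>v\<in>L. v \<noteq> 0 \<longrightarrow> d \<le> sup_norm v) \<Longrightarrow>
     (\<exists>r b c \<beta>. r \<le> s \<and> reduced_basis C d L r b c \<beta>)" by blast
  \<comment> \<open>The lower bounds \<open>1\<close> and \<open>C + 1\<close> serve the sizes of
    \<open>b0\<close> and of the lifts, \<open>4 * C\<close> the dual vectors \<open>g\<close>, and
    \<open>1 + 2 * C * s\<close> the dual vector \<open>c0\<close>.\<close>
  define D where "D = 1 + 4 * C + 2 * C * s"
  have D: "D \<ge> 1" "D \<ge> C + 1" "D \<ge> 4 * C" "D \<ge> 1 + 2 * C * s"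
    using C by (auto simp: D_def intro!: add_increasing2)
  have "\<exists>r b c \<beta>. r \<le> Suc s \<and> reduced_basis D d L r b c \<beta>"
    if cS: "card S \<le> Suc s" and L: "additive_subgroup L" and N: "N \<noteq> 0"
     and NL: "\<forall>v\<in>L. \<forall>k. N * v $ k \<in> \<int>" and SL: "\<forall>v\<in>L. \<forall>k. k \<notin> S \<longrightarrow> v $ k = 0" and d: "0 < d"
     and dL: "\<forall>v\<in>L. v \<noteq> 0 \<longrightarrow> d \<le> sup_norm v"
    for S :: "'n set" and L :: "(real^'n) set" and N d
  proof (cases "\<exists>v\<in>L. v \<noteq> 0")
    case False
    then show ?thesis by (intro exI[of _ 0]) (simp add: reduced_basis_def)
  next
    case True
    obtain b0 where b0: "b0 \<in> L" "b0 \<noteq> 0" and short: "\<And>v. v \<in> L \<Longrightarrow> v \<noteq> 0 \<Longrightarrow> sup_norm b0 \<le> sup_norm v"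
      using shortest_vector[of N L] N NL True by metis
    define e where "e = sup_norm b0"
    obtain p where p: "e = \<bar>b0 $ p\<bar>" unfolding e_def by (rule sup_norm_attained)
    have e: "d \<le> e" using dL b0 by (auto simp: e_def)
    then have e0: "e > 0" using d by simp
    then have b0p: "b0 $ p \<noteq> 0" using p by auto
    have b0e: "\<bar>b0 $ k\<bar> \<le> e" for k by (simp add: e_def component_le_sup_norm)
    define \<pi> where "\<pi> = (\<lambda>v. v - (v $ p / b0 $ p) *\<^sub>R b0)"
    have pS: "p \<in> S" using SL b0 b0p by blast
    have \<pi>b0: "\<pi> b0 = 0" using b0p by (simp add: \<pi>_def)
    have \<pi>diff: "\<pi> (x - y) = \<pi> x - \<pi> y" for x y
      by (simp add: \<pi>_def diff_divide_distrib scaleR_diff_left)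
    have \<pi>scale: "\<pi> (t *\<^sub>R x) = t *\<^sub>R \<pi> x" for x t
      by (simp add: \<pi>_def scaleR_diff_right)
    have \<pi>sum: "\<pi> (sum f I) = (\<Sum>i\<in>I. \<pi> (f i))" for f and I :: "nat set"
      by (simp add: \<pi>_def sum_divide_distrib sum_subtractf scaleR_sum_left)
    \<comment> \<open>Size reduction: subtracting from a preimage the rounded multiple of
      \<open>b0\<close> leaves a coefficient of at most 1/2.\<close>
    have lift: "\<exists>w\<in>L. \<exists>t. \<bar>t\<bar> \<le> 1/2 \<and> w = u + t *\<^sub>R b0" if "u \<in> \<pi> ` L" for u
    proof -
      from that obtain v where v: "v \<in> L" "u = \<pi> v" by auto
      let ?t = "v $ p / b0 $ p"
      have "v - real_of_int (round ?t) *\<^sub>R b0 \<in> L"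
        by (intro additive_subgroup_diff[OF L] v additive_subgroup_scale_int[OF L] b0)
      moreover have "v - real_of_int (round ?t) *\<^sub>R b0 = u + (?t - round ?t) *\<^sub>R b0"
        by (simp add: v \<pi>_def scaleR_diff_left)
      moreover have "\<bar>?t - round ?t\<bar> \<le> 1/2"
        using of_int_round_abs_le[of ?t] by (simp add: abs_minus_commute)
      ultimately show ?thesis by blast
    qed
    have L': "additive_subgroup (\<pi> ` L)"
      unfolding additive_subgroup_def
    proof (intro conjI ballI)
      show "0 \<in> \<pi> ` L" using b0 \<pi>b0 by force
      fix x y assume "x \<in> \<pi> ` L" "y \<in> \<pi> ` L"
      then show "x - y \<in> \<pi> ` L" using \<pi>diff additive_subgroup_diff[OF L] by (auto simp flip: \<pi>diff)
    qed
    \<comment> \<open>Clearing the denominator of \<open>v $ p / b0 $ p\<close> costs the extra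
      factor \<open>N * b0 $ p\<close>, a nonzero integer.\<close>
    have N': "\<forall>v\<in>\<pi> ` L. \<forall>k. (N * (N * b0 $ p)) * v $ k \<in> \<int>"
    proof (intro ballI allI)
      fix u k assume "u \<in> \<pi> ` L"
      then obtain v where v: "v \<in> L" "u = \<pi> v" by auto
      have "(N * (N * b0 $ p)) * u $ k = (N * b0 $ p) * (N * v $ k) - (N * v $ p) * (N * b0 $ k)"
        using b0p by (simp add: v \<pi>_def field_simps)
      also have "\<dots> \<in> \<int>" using NL v(1) b0(1) by (metis Ints_diff Ints_mult)
      finally show "(N * (N * b0 $ p)) * u $ k \<in> \<int>" .
    qed
    have S': "\<forall>v\<in>\<pi> ` L. \<forall>k. k \<notin> S - {p} \<longrightarrow> v $ k = 0"
      using SL b0 b0p by (auto simp: \<pi>_def)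
    have cS': "card (S - {p}) \<le> s" using cS pS by simp
    \<comment> \<open>The lift of a nonzero vector is a nonzero vector of \<open>L\<close>, hence of
      norm at least \<open>e\<close>, and its multiple of \<open>b0\<close> accounts for at most
      \<open>e / 2\<close>.\<close>
    have d': "\<forall>v\<in>\<pi> ` L. v \<noteq> 0 \<longrightarrow> e / 2 \<le> sup_norm v"
    proof (intro ballI impI)
      fix u assume u: "u \<in> \<pi> ` L" "u \<noteq> 0"
      from lift[OF u(1)] obtain w t where w: "w \<in> L" "\<bar>t\<bar> \<le> 1/2" "w = u + t *\<^sub>R b0" by blast
      have up: "u $ p = 0" using S' u by blast
      have "w \<noteq> 0"
      proof
        assume "w = 0"
        then have "w $ p = 0" by simp
        then have "t = 0" using up w b0p by simp
        then show False using w u \<open>w = 0\<close> by simp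
      qed
      then have "e \<le> sup_norm w" using short w e_def by blast
      obtain k where k: "sup_norm w = \<bar>w $ k\<bar>" by (rule sup_norm_attained)
      have "\<bar>t * b0 $ k\<bar> \<le> (1/2) * e" unfolding abs_mult by (intro mult_mono w b0e) auto
      moreover have "\<bar>w $ k\<bar> \<le> \<bar>u $ k\<bar> + \<bar>t * b0 $ k\<bar>" using w by simp
      ultimately show "e / 2 \<le> sup_norm u"
        using \<open>e \<le> sup_norm w\<close> k component_le_sup_norm[of u k] by linarith
    qed
    \<comment> \<open>Using \<open>e / 2\<close> in place of \<open>d\<close> gives
      \<open>e \<le> 2 * \<beta>' i\<close>, so the doubled sizes remain increasing when
      \<open>e\<close> is put in front of them.\<close>
    from IH[OF cS' L' _ N' S' _ d'] N b0p e0
    obtain r b' c' \<beta>' where r: "r \<le> s" and red: "reduced_basis C (e/2) (\<pi> ` L) r b' c' \<beta>'" by auto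
    have b'L: "\<And>i. i < r \<Longrightarrow> b' i \<in> \<pi> ` L"
      and comb: "\<And>v. v \<in> \<pi> ` L \<Longrightarrow> \<exists>m::nat \<Rightarrow> int. v = (\<Sum>i<r. real_of_int (m i) *\<^sub>R b' i)"
      and dual: "\<And>i j. i < r \<Longrightarrow> j < r \<Longrightarrow> inner (c' i) (b' j) = (if i = j then 1 else 0)"
      and \<beta>'e: "\<And>i. i < r \<Longrightarrow> e/2 \<le> \<beta>' i" and \<beta>'mono: "\<And>i j. i \<le> j \<Longrightarrow> j < r \<Longrightarrow> \<beta>' i \<le> \<beta>' j"
      and b'bd: "\<And>i k. i < r \<Longrightarrow> \<bar>b' i $ k\<bar> \<le> C * \<beta>' i"
      and c'bd: "\<And>i. i < r \<Longrightarrow> (\<Sum>k\<in>UNIV. \<bar>c' i $ k\<bar>) * \<beta>' i \<le> C"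
      using red unfolding reduced_basis_def by blast+
    have "\<forall>i. \<exists>w t. i < r \<longrightarrow> w \<in> L \<and> \<bar>t\<bar> \<le> 1/2 \<and> w = b' i + t *\<^sub>R b0"
      using lift b'L by blast
    then obtain l \<tau> where l: "\<And>i. i < r \<Longrightarrow> l i \<in> L" and \<tau>: "\<And>i. i < r \<Longrightarrow> \<bar>\<tau> i\<bar> \<le> (1/2::real)"
      and l_eq: "\<And>i. i < r \<Longrightarrow> l i = b' i + \<tau> i *\<^sub>R b0" by metis
    have b'p: "b' i $ p = 0" if "i < r" for i using S' b'L[OF that] by blast
    have \<pi>l: "\<pi> (l i) = b' i" if "i < r" for i
      using b'p[OF that] b0p by (simp add: \<pi>_def l_eq[OF that])
    \<comment> \<open>The pullback of \<open>c' i\<close> along \<open>\<pi>\<close>: it vanishes on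
      \<open>b0\<close> and is dual to the lifts.\<close>
    define g where "g = (\<lambda>i. c' i - (inner (c' i) b0 / b0 $ p) *\<^sub>R axis p 1)"
    have g_inner: "inner (g i) v = inner (c' i) (\<pi> v)" for i v
      by (simp add: g_def \<pi>_def inner_diff_left inner_diff_right inner_axis' )
    have g_norm: "(\<Sum>k\<in>UNIV. \<bar>g i $ k\<bar>) \<le> 2 * (\<Sum>k\<in>UNIV. \<bar>c' i $ k\<bar>)" for i
    proof -
      let ?q = "inner (c' i) b0 / b0 $ p"
      have "\<bar>inner (c' i) b0\<bar> \<le> (\<Sum>k\<in>UNIV. \<bar>c' i $ k\<bar> * e)"
        unfolding inner_vec_def
        by (rule order_trans[OF sum_abs]) (auto simp: abs_mult intro!: sum_mono mult_left_mono b0e)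
      then have q: "\<bar>?q\<bar> \<le> (\<Sum>k\<in>UNIV. \<bar>c' i $ k\<bar>)"
        using e0 by (simp add: p[symmetric] divide_le_eq sum_distrib_right)
      have "(\<Sum>k\<in>UNIV. \<bar>g i $ k\<bar>) \<le> (\<Sum>k\<in>UNIV. \<bar>c' i $ k\<bar> + (if k = p then \<bar>?q\<bar> else 0))"
        by (intro sum_mono) (auto simp: g_def axis_def abs_triangle_ineq4 simp del: abs_divide)
      also have "\<dots> = (\<Sum>k\<in>UNIV. \<bar>c' i $ k\<bar>) + \<bar>?q\<bar>" by (simp add: sum.distrib)
      finally show ?thesis using q by linarith
    qed
    have g_dual: "inner (g i) (l j) = (if i = j then 1 else 0)" if "i < r" "j < r" for i j
      using that by (simp add: g_inner \<pi>l dual)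
    have g_b0: "inner (g i) b0 = 0" for i by (simp add: g_inner \<pi>b0)
    have g_bd: "(\<Sum>k\<in>UNIV. \<bar>g i $ k\<bar>) * (2 * \<beta>' i) \<le> 4 * C" if "i < r" for i
    proof -
      have "(\<Sum>k\<in>UNIV. \<bar>g i $ k\<bar>) * (2 * \<beta>' i) \<le> 2 * (\<Sum>k\<in>UNIV. \<bar>c' i $ k\<bar>) * (2 * \<beta>' i)"
        using \<beta>'e[OF that] e0 by (intro mult_right_mono g_norm) linarith
      then show ?thesis using c'bd[OF that] by (simp add: mult.commute mult.left_commute)
    qed
    \<comment> \<open>The functional \<open>v $ p / b0 $ p\<close> is 1 on \<open>b0\<close> but
      \<open>\<tau> j\<close> on the lift \<open>l j\<close>, because \<open>b' j\<close> vanishes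
      at \<open>p\<close>; the vectors \<open>g j\<close> remove these values.\<close>
    define c0 where "c0 = (1 / b0 $ p) *\<^sub>R axis p 1 - (\<Sum>j<r. \<tau> j *\<^sub>R g j)"
    have c0b0: "inner c0 b0 = 1"
      using b0p by (simp add: c0_def inner_diff_left inner_sum_left g_b0 inner_axis')
    have c0l: "inner c0 (l j) = 0" if "j < r" for j
    proof -
      have "(\<Sum>i<r. \<tau> i * inner (g i) (l j)) = (\<Sum>i<r. if i = j then \<tau> i else 0)"
        using that by (intro sum.cong) (auto simp: g_dual)
      also have "\<dots> = \<tau> j" using that by simp
      finally show ?thesis
        using b0p by (simp add: c0_def inner_diff_left inner_sum_left inner_axis' l_eq[OF that] b'p[OF that])
    qed
    have c0bd: "(\<Sum>k\<in>UNIV. \<bar>c0 $ k\<bar>) * e \<le> 1 + 2 * C * s"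
    proof -
      have "(\<Sum>k\<in>UNIV. \<bar>c0 $ k\<bar>) \<le> (\<Sum>k\<in>UNIV. (if k = p then 1 / e else 0) + (\<Sum>j<r. \<bar>\<tau> j * g j $ k\<bar>))"
      proof (intro sum_mono)
        fix k
        have "\<bar>c0 $ k\<bar> \<le> \<bar>if k = p then 1 / b0 $ p else 0\<bar> + \<bar>\<Sum>j<r. \<tau> j * g j $ k\<bar>"
          by (auto simp: c0_def axis_def abs_triangle_ineq4 simp del: abs_divide)
        also have "\<bar>\<Sum>j<r. \<tau> j * g j $ k\<bar> \<le> (\<Sum>j<r. \<bar>\<tau> j * g j $ k\<bar>)" by (rule sum_abs)
        finally show "\<bar>c0 $ k\<bar> \<le> (if k = p then 1 / e else 0) + (\<Sum>j<r. \<bar>\<tau> j * g j $ k\<bar>)"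
          by (auto simp: p)
      qed
      also have "\<dots> = 1 / e + (\<Sum>j<r. \<bar>\<tau> j\<bar> * (\<Sum>k\<in>UNIV. \<bar>g j $ k\<bar>))"
        by (subst sum.distrib, subst sum.swap) (simp add: abs_mult sum_distrib_left)
      also have "\<dots> \<le> 1 / e + (\<Sum>j<r. (1/2) * (4 * C / e))"
      proof (intro add_left_mono sum_mono mult_mono)
        fix j assume "j \<in> {..<r}"
        then have j: "j < r" by simp
        show "\<bar>\<tau> j\<bar> \<le> 1/2" using \<tau>[OF j] .
        have "(\<Sum>k\<in>UNIV. \<bar>g j $ k\<bar>) * e \<le> (\<Sum>k\<in>UNIV. \<bar>g j $ k\<bar>) * (2 * \<beta>' j)"
          using \<beta>'e[OF j] by (intro mult_left_mono) (auto intro: sum_nonneg)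
        then have "(\<Sum>k\<in>UNIV. \<bar>g j $ k\<bar>) * e \<le> 4 * C"
          using g_bd[OF j] by (rule order_trans)
        then show "(\<Sum>k\<in>UNIV. \<bar>g j $ k\<bar>) \<le> 4 * C / e"
          using e0 by (simp only: le_divide_eq if_True)
      qed (auto intro: sum_nonneg)
      also have "\<dots> = (1 + 2 * C * r) / e" using e0 by (simp add: field_simps)
      also have "\<dots> \<le> (1 + 2 * C * s) / e"
        using e0 r C by (intro divide_right_mono add_left_mono mult_left_mono) auto
      finally show ?thesis using e0 by (simp add: le_divide_eq)
    qed
    define b where "b = (\<lambda>i. case i of 0 \<Rightarrow> b0 | Suc j \<Rightarrow> l j)"
    define c where "c = (\<lambda>i. case i of 0 \<Rightarrow> c0 | Suc j \<Rightarrow> g j)"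
    define \<beta> where "\<beta> = (\<lambda>i. case i of 0 \<Rightarrow> e | Suc j \<Rightarrow> 2 * \<beta>' j)"
    have "reduced_basis D d L (Suc r) b c \<beta>"
      unfolding reduced_basis_def
    proof (intro conjI allI impI ballI)
      fix i assume "i < Suc r"
      then show "b i \<in> L" using l b0 by (cases i) (auto simp: b_def)
    next
      fix v assume v: "v \<in> L"
      obtain m :: "nat \<Rightarrow> int" where m: "\<pi> v = (\<Sum>i<r. real_of_int (m i) *\<^sub>R b' i)"
        using comb v by blast
      \<comment> \<open>Modulo the lifts, \<open>v\<close> is a multiple \<open>t\<close> of
        \<open>b0\<close>. The fractional remainder of \<open>t\<close> gives a vector of
        \<open>L\<close> of norm at most \<open>e / 2\<close>, which is zero by minimality of
        \<open>b0\<close>.\<close>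
      define w where "w = v - (\<Sum>i<r. real_of_int (m i) *\<^sub>R l i)"
      have w: "w \<in> L" unfolding w_def
        by (intro additive_subgroup_diff[OF L] v additive_subgroup_sum[OF L] additive_subgroup_scale_int[OF L] l) auto
      have "\<pi> w = 0" by (simp add: w_def \<pi>diff \<pi>sum \<pi>scale m \<pi>l)
      define t where "t = w $ p / b0 $ p"
      have wt: "w = t *\<^sub>R b0" using \<open>\<pi> w = 0\<close> by (simp add: \<pi>_def t_def)
      define z where "z = w - real_of_int (round t) *\<^sub>R b0"
      have z: "z \<in> L" unfolding z_def by (intro additive_subgroup_diff[OF L] w additive_subgroup_scale_int[OF L] b0)
      have zt: "z = (t - round t) *\<^sub>R b0" by (simp add: z_def wt scaleR_diff_left)
      have "z = 0"
      proof (rule ccontr)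
        assume "z \<noteq> 0"
        then have 1: "e \<le> sup_norm z" using short z e_def by blast
        obtain k where k: "sup_norm z = \<bar>z $ k\<bar>" by (rule sup_norm_attained)
        have "\<bar>t - round t\<bar> * \<bar>b0 $ k\<bar> \<le> (1/2) * e"
          using of_int_round_abs_le[of t] by (intro mult_mono b0e) (auto simp: abs_minus_commute)
        then show False using 1 k e0 by (simp add: zt abs_mult)
      qed
      then have "v = real_of_int (round t) *\<^sub>R b0 + (\<Sum>i<r. real_of_int (m i) *\<^sub>R l i)"
        by (simp add: z_def w_def algebra_simps)
      then show "\<exists>m::nat \<Rightarrow> int. v = (\<Sum>i<Suc r. real_of_int (m i) *\<^sub>R b i)"
        by (intro exI[of _ "\<lambda>i. case i of 0 \<Rightarrow> round t | Suc j \<Rightarrow> m j"])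
          (simp add: sum.lessThan_Suc_shift b_def del: sum.lessThan_Suc)
    next
      fix i j assume "i < Suc r" "j < Suc r"
      then show "inner (c i) (b j) = (if i = j then 1 else 0)"
        by (cases i; cases j) (auto simp: b_def c_def c0b0 c0l g_b0 g_dual)
    next
      fix i assume "i < Suc r"
      then show "d \<le> \<beta> i" using e \<beta>'e by (cases i) (force simp: \<beta>_def)+
    next
      fix i j assume "i \<le> j" "j < Suc r"
      then show "\<beta> i \<le> \<beta> j" using \<beta>'mono \<beta>'e by (cases i; cases j) (force simp: \<beta>_def)+
    next
      fix i k assume i: "i < Suc r"
      show "\<bar>b i $ k\<bar> \<le> D * \<beta> i"
      proof (cases i)
        case 0
        have "1 * e \<le> D * e" using D e0 by (intro mult_right_mono) auto
        then show ?thesis using 0 b0e[of k] by (simp add: b_def \<beta>_def)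
      next
        case (Suc j)
        then have j: "j < r" using i by simp
        have "\<bar>\<tau> j\<bar> * \<bar>b0 $ k\<bar> \<le> (1/2) * e" using \<tau>[OF j] by (intro mult_mono b0e) auto
        then have "\<bar>l j $ k\<bar> \<le> C * \<beta>' j + e / 2"
          using b'bd[OF j, of k] abs_triangle_ineq[of "b' j $ k" "\<tau> j * b0 $ k"]
          by (simp add: l_eq[OF j] abs_mult)
        also have "\<dots> \<le> (C + 1) * \<beta>' j" using \<beta>'e[OF j] by (simp add: algebra_simps)
        also have "\<dots> \<le> D * (2 * \<beta>' j)" using D C \<beta>'e[OF j] e0 by (intro mult_mono) auto
        finally show ?thesis by (simp add: Suc b_def \<beta>_def)
      qed
    next
      fix i assume i: "i < Suc r"
      show "(\<Sum>k\<in>UNIV. \<bar>c i $ k\<bar>) * \<beta> i \<le> D"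
      proof (cases i)
        case 0
        then show ?thesis using c0bd D(4) by (simp add: c_def \<beta>_def)
      next
        case (Suc j)
        then show ?thesis using order_trans[OF g_bd D(3)] i by (simp add: c_def \<beta>_def)
      qed
    qed
    then show ?thesis using r by (intro exI[of _ "Suc r"]) auto
  qed
  then show ?case using D(1) by (intro exI[of _ D]) blast
qed

section \<open>Counting matrices with a basis of given sizes\<close>

definition index_pairs :: "nat \<Rightarrow> (nat \<times> nat) set" where
  "index_pairs r = {(i, j). i < j \<and> j < r}"

lemma finite_index_pairs [simp]: "finite (index_pairs r)"
  by (rule finite_subset[of _ "{..<r} \<times> {..<r}"]) (auto simp: index_pairs_def)

text \<open>The recursion inverts the substitution: \<open>b\<close> is recovered from the new vectors
  \<open>b'\<close> as \<open>b j = b' j + (\<Sum>i<j. m (i, j) *s b' i)\<close>, so that the Gram coefficients in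
  the new basis are explicit.\<close>

fun unipotent_change :: "(nat \<times> nat \<Rightarrow> int) \<Rightarrow> (nat \<Rightarrow> int^'n) \<Rightarrow> nat \<Rightarrow> int^'n" where
  "unipotent_change m b j = b j - (\<Sum>i<j. m (i, j) *s unipotent_change m b i)"

declare unipotent_change.simps [simp del]

lemma unipotent_change_component:
  "unipotent_change m b j $ k = b j $ k - (\<Sum>i<j. m (i, j) * unipotent_change m b i $ k)"
  by (subst unipotent_change.simps) simp

text \<open>The coefficient bound \<open>B j / B i\<close> trades the size \<open>B i\<close> of an
  earlier vector for \<open>B j\<close>, and the factors \<open>2 ^ i\<close> for
  \<open>i < j\<close> add up to \<open>2 ^ j - 1\<close>.\<close>

lemma unipotent_change_bound:
  fixes B :: "nat \<Rightarrow> real"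
  assumes b: "\<And>i k. i < r \<Longrightarrow> \<bar>real_of_int (b i $ k)\<bar> \<le> K * B i"
    and B: "\<And>i. i < r \<Longrightarrow> B i > 0"
    and m: "\<And>i j. i < j \<Longrightarrow> j < r \<Longrightarrow> \<bar>real_of_int (m (i, j))\<bar> \<le> B j / B i"
    and "j < r"
  shows "\<bar>real_of_int (unipotent_change m b j $ k)\<bar> \<le> K * 2 ^ j * B j"
  using \<open>j < r\<close>
proof (induction j rule: less_induct)
  case (less j)
  let ?c = "unipotent_change m b"
  have "\<bar>\<Sum>i<j. real_of_int (m (i, j)) * real_of_int (?c i $ k)\<bar>
      \<le> (\<Sum>i<j. \<bar>real_of_int (m (i, j)) * real_of_int (?c i $ k)\<bar>)"
    by (rule sum_abs)
  also have "\<dots> \<le> (\<Sum>i<j. K * B j * 2 ^ i)"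
  proof (rule sum_mono)
    fix i assume "i \<in> {..<j}"
    then have i: "i < j" "i < r" using less by auto
    have "\<bar>real_of_int (m (i, j)) * real_of_int (?c i $ k)\<bar> \<le> B j / B i * (K * 2 ^ i * B i)"
      unfolding abs_mult using i less B[of i] B[of j] by (intro mult_mono m) auto
    also have "\<dots> = K * B j * 2 ^ i" using B[of i] i by simp
    finally show "\<bar>real_of_int (m (i, j)) * real_of_int (?c i $ k)\<bar> \<le> K * B j * 2 ^ i" .
  qed
  also have "\<dots> = K * B j * (2 ^ j - 1)"
    by (simp add: sum_distrib_left[symmetric] power_diff_1_eq lessThan_atLeast0 sum_gp_strict)
  finally have "\<bar>\<Sum>i<j. real_of_int (m (i, j)) * real_of_int (?c i $ k)\<bar> \<le> K * B j * (2 ^ j - 1)" .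
  then have "\<bar>real_of_int (?c j $ k)\<bar> \<le> K * B j + K * B j * (2 ^ j - 1)"
    using b[OF less.prems, of k]
    by (subst unipotent_change_component) (simp add: abs_le_iff; linarith)
  then show ?case by (simp add: algebra_simps)
qed

text \<open>By unitriangularity, \<open>b j\<close> is altered only by new vectors of smaller index,
  on which \<open>c i\<close> vanishes by induction. For \<open>j > i\<close> the pairing need not
  vanish.\<close>

lemma unipotent_change_dual:
  fixes c :: "nat \<Rightarrow> real^'n"
  assumes dual: "\<And>i j. i < r \<Longrightarrow> j < r \<Longrightarrow>
      (\<Sum>k\<in>UNIV. c i $ k * real_of_int (b j $ k)) = (if i = j then 1 else 0)"
    and "i < r" "j \<le> i"
  shows "(\<Sum>k\<in>UNIV. c i $ k * real_of_int (unipotent_change m b j $ k)) = (if i = j then 1 else 0)"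
  using \<open>j \<le> i\<close>
proof (induction j rule: less_induct)
  case (less j)
  let ?c = "unipotent_change m b"
  have "(\<Sum>k\<in>UNIV. c i $ k * real_of_int (?c j $ k))
      = (\<Sum>k\<in>UNIV. c i $ k * real_of_int (b j $ k))
        - (\<Sum>k\<in>UNIV. c i $ k * (\<Sum>l<j. real_of_int (m (l, j)) * real_of_int (?c l $ k)))"
    by (subst unipotent_change_component) (simp add: right_diff_distrib sum_subtractf)
  also have "(\<Sum>k\<in>UNIV. c i $ k * (\<Sum>l<j. real_of_int (m (l, j)) * real_of_int (?c l $ k)))
      = (\<Sum>l<j. real_of_int (m (l, j)) * (\<Sum>k\<in>UNIV. c i $ k * real_of_int (?c l $ k)))"
    unfolding sum_distrib_left by (subst sum.swap) (simp add: mult_ac)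
  also have "\<dots> = 0" using less by (intro sum.neutral) auto
  finally show ?case using dual[of i j] assms less.prems by simp
qed

text \<open>Equal new vectors give a linear relation whose coefficients are the differences
  \<open>m (l, j) - m' (l, j)\<close>. Pairing it with \<open>c a\<close>, where \<open>a\<close> is
  the largest index with a nonzero difference, isolates that difference; a smaller index would meet
  pairings that are not known to vanish.\<close>

lemma unipotent_change_inj:
  fixes c :: "nat \<Rightarrow> real^'n"
  assumes dual: "\<And>i j. i < r \<Longrightarrow> j < r \<Longrightarrow>
      (\<Sum>k\<in>UNIV. c i $ k * real_of_int (b j $ k)) = (if i = j then 1 else 0)"
    and eq: "\<And>j. j < r \<Longrightarrow> unipotent_change m b j = unipotent_change m' b j"
    and "i < j" "j < r"
  shows "m (i, j) = m' (i, j)"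
proof (rule ccontr)
  let ?c = "unipotent_change m b"
  assume "m (i, j) \<noteq> m' (i, j)"
  define I where "I = {i. i < j \<and> m (i, j) \<noteq> m' (i, j)}"
  define a where "a = Max I"
  have fin: "finite I" and "I \<noteq> {}" using \<open>i < j\<close> \<open>m (i, j) \<noteq> m' (i, j)\<close> by (auto simp: I_def)
  then have "a \<in> I" unfolding a_def by (rule Max_in)
  have max: "l \<le> a" if "l \<in> I" for l using that fin by (simp add: a_def)
  have *: "(\<Sum>l<j. (m (l, j) - m' (l, j)) * ?c l $ k) = 0" for k
  proof -
    have "(\<Sum>l<j. m (l, j) * ?c l $ k) = (\<Sum>l<j. m' (l, j) * unipotent_change m' b l $ k)"
      using unipotent_change_component[of m b j k] unipotent_change_component[of m' b j k] eq[OF \<open>j < r\<close>]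
      by simp
    also have "\<dots> = (\<Sum>l<j. m' (l, j) * ?c l $ k)"
      using \<open>j < r\<close> by (intro sum.cong) (auto simp: eq)
    finally show ?thesis by (simp add: left_diff_distrib sum_subtractf)
  qed
  have "0 = (\<Sum>k\<in>UNIV. c a $ k * real_of_int (\<Sum>l<j. (m (l, j) - m' (l, j)) * ?c l $ k))"
    unfolding * by simp
  also have "\<dots> = (\<Sum>l<j. real_of_int (m (l, j) - m' (l, j)) * (\<Sum>k\<in>UNIV. c a $ k * real_of_int (?c l $ k)))"
    unfolding sum_distrib_left of_int_sum by (subst sum.swap) (simp add: mult_ac)
  also have "\<dots> = (\<Sum>l<j. if l = a then real_of_int (m (l, j) - m' (l, j)) else 0)"
  proof (rule sum.cong)
    fix l assume "l \<in> {..<j}"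
    then have l: "l < j" by simp
    show "real_of_int (m (l, j) - m' (l, j)) * (\<Sum>k\<in>UNIV. c a $ k * real_of_int (?c l $ k))
        = (if l = a then real_of_int (m (l, j) - m' (l, j)) else 0)"
    proof (cases "l \<le> a")
      case True
      then show ?thesis
        using unipotent_change_dual[where c = c and b = b and r = r and i = a and j = l and m = m] dual \<open>a \<in> I\<close> \<open>j < r\<close>
        by (auto simp: I_def)
    next
      case False
      then have "l \<notin> I" using max by blast
      then show ?thesis using l False by (auto simp: I_def)
    qed
  qed simp
  also have "\<dots> \<noteq> 0" using \<open>a \<in> I\<close> by (auto simp: I_def)
  finally show False by simp
qed

text \<open>Gram matrices transform by congruence: substituting new vectors through \<open>u\<close>
  replaces the matrix \<open>x\<close> by \<open>u\<close> times \<open>x\<close> times the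
  transpose of \<open>u\<close>.\<close>

lemma bilinear_form_substitution:
  fixes x u :: "nat \<Rightarrow> nat \<Rightarrow> 'a::comm_ring_1"
  shows "(\<Sum>k<r. \<Sum>l<r. x k l * (\<Sum>i<r. u i k * p i) * (\<Sum>j<r. u j l * q j))
    = (\<Sum>i<r. \<Sum>j<r. (\<Sum>k<r. \<Sum>l<r. u i k * x k l * u j l) * p i * q j)"
proof -
  define f where "f = (\<lambda>k l i j. u i k * x k l * u j l * p i * q j)"
  have "x k l * (\<Sum>i<r. u i k * p i) * (\<Sum>j<r. u j l * q j) = (\<Sum>i<r. \<Sum>j<r. f k l i j)" for k l
  proof -
    have "x k l * (\<Sum>i<r. u i k * p i) * (\<Sum>j<r. u j l * q j)
        = x k l * (\<Sum>i<r. \<Sum>j<r. (u i k * p i) * (u j l * q j))"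
      by (simp only: mult.assoc[of "x k l"] sum_product)
    also have "\<dots> = (\<Sum>i<r. \<Sum>j<r. x k l * ((u i k * p i) * (u j l * q j)))"
      by (simp only: sum_distrib_left)
    also have "\<dots> = (\<Sum>i<r. \<Sum>j<r. f k l i j)"
      by (intro sum.cong refl) (simp only: f_def mult_ac)
    finally show ?thesis .
  qed
  then have "(\<Sum>k<r. \<Sum>l<r. x k l * (\<Sum>i<r. u i k * p i) * (\<Sum>j<r. u j l * q j))
      = (\<Sum>k<r. \<Sum>l<r. \<Sum>i<r. \<Sum>j<r. f k l i j)"
    by simp
  also have "\<dots> = (\<Sum>k<r. \<Sum>i<r. \<Sum>l<r. \<Sum>j<r. f k l i j)"
    by (rule sum.cong[OF refl], rule sum.swap)
  also have "\<dots> = (\<Sum>i<r. \<Sum>k<r. \<Sum>l<r. \<Sum>j<r. f k l i j)" by (rule sum.swap)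
  also have "\<dots> = (\<Sum>i<r. \<Sum>k<r. \<Sum>j<r. \<Sum>l<r. f k l i j)"
    by (rule sum.cong[OF refl], rule sum.cong[OF refl], rule sum.swap)
  also have "\<dots> = (\<Sum>i<r. \<Sum>j<r. \<Sum>k<r. \<Sum>l<r. f k l i j)"
    by (rule sum.cong[OF refl], rule sum.swap)
  also have "\<dots> = (\<Sum>i<r. \<Sum>j<r. (\<Sum>k<r. \<Sum>l<r. u i k * x k l * u j l) * p i * q j)"
    by (simp add: f_def sum_distrib_right)
  finally show ?thesis .
qed

section \<open>Counting integer points in boxes\<close>

lemma card_int_box_le:
  fixes M :: real
  assumes "M \<ge> 0"
  shows "finite {z::int. \<bar>real_of_int z\<bar> \<le> M}" "real (card {z::int. \<bar>real_of_int z\<bar> \<le> M}) \<le> 2 * M + 1"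
proof -
  have *: "{z::int. \<bar>real_of_int z\<bar> \<le> M} = {-\<lfloor>M\<rfloor>..\<lfloor>M\<rfloor>}"
    by (auto simp: abs_le_iff le_floor_iff) linarith+
  show "finite {z::int. \<bar>real_of_int z\<bar> \<le> M}" unfolding * by simp
  have "real (card {z::int. \<bar>real_of_int z\<bar> \<le> M}) = 2 * of_int \<lfloor>M\<rfloor> + 1"
    unfolding * using assms by simp
  then show "real (card {z::int. \<bar>real_of_int z\<bar> \<le> M}) \<le> 2 * M + 1" by linarith
qed

lemma card_int_vec_box_le:
  fixes M :: real
  assumes "M \<ge> 0"
  shows "finite {v::int^'n. \<forall>k. \<bar>real_of_int (v $ k)\<bar> \<le> M}" (is "finite ?V")
    "real (card {v::int^'n. \<forall>k. \<bar>real_of_int (v $ k)\<bar> \<le> M}) \<le> (2 * M + 1) ^ CARD('n::finite)"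
proof -
  let ?I = "{z::int. \<bar>real_of_int z\<bar> \<le> M}"
  let ?P = "PiE (UNIV :: 'n set) (\<lambda>_. ?I)"
  have fin: "finite ?P" by (intro finite_PiE card_int_box_le assms) auto
  have inj: "inj_on vec_nth ?V" by (auto simp: inj_on_def vec_nth_inject)
  have sub: "vec_nth ` ?V \<subseteq> ?P" by auto
  show "finite ?V" using inj sub fin by (metis finite_imageD finite_subset)
  have "card ?V \<le> card ?P" using inj sub fin by (rule card_inj_on_le)
  also have "card ?P = card ?I ^ CARD('n)" by (simp add: card_PiE)
  finally have "real (card ?V) \<le> real (card ?I) ^ CARD('n)"
    by (metis of_nat_mono of_nat_power)
  also have "\<dots> \<le> (2 * M + 1) ^ CARD('n)"
    by (intro power_mono card_int_box_le assms) auto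
  finally show "real (card ?V) \<le> (2 * M + 1) ^ CARD('n)" .
qed

text \<open>The factorisation of \<open>A\<close> as the transpose of \<open>b\<close> times
  \<open>x\<close> times \<open>b\<close>, with the rows \<open>b i\<close> of size about
  \<open>B i\<close>. The dual family \<open>c\<close> certifies that these rows are independent,
  which \<open>unipotent_change_inj\<close> requires.\<close>

definition presentation ::
  "nat \<Rightarrow> (nat \<Rightarrow> real) \<Rightarrow> real \<Rightarrow> real \<Rightarrow> int^'n^'n \<Rightarrow> (nat \<Rightarrow> int^'n) \<Rightarrow> (nat \<Rightarrow> real^'n) \<Rightarrow> (nat \<Rightarrow> nat \<Rightarrow> int) \<Rightarrow> bool"
  where
  "presentation r B K T A b c x \<longleftrightarrow>
     (\<forall>i<r. \<forall>k. \<bar>real_of_int (b i $ k)\<bar> \<le> K * B i) \<and>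
     (\<forall>i<r. \<forall>j<r. (\<Sum>k\<in>UNIV. c i $ k * real_of_int (b j $ k)) = (if i = j then 1 else 0)) \<and>
     (\<forall>i<r. \<forall>j<r. \<bar>real_of_int (x i j)\<bar> \<le> K * T / (B i * B j)) \<and>
     (\<forall>i<r. \<forall>j<r. x i j = - x j i) \<and>
     (\<forall>k l. A $ k $ l = (\<Sum>i<r. \<Sum>j<r. x i j * b i $ k * b j $ l))"

definition presented_matrices :: "nat \<Rightarrow> (nat \<Rightarrow> real) \<Rightarrow> real \<Rightarrow> real \<Rightarrow> (int^'n^'n) set" where
  "presented_matrices r B K T = {A. \<exists>b c x. presentation r B K T A b c x}"

text \<open>The factor on the left-hand side counts the bases obtained from a given one by unipotent
  changes with \<open>0 \<le> m (i, j) < B j / B i\<close>; all of them satisfy the same size bounds up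
  to constants, and the right-hand side counts all pairs of a basis and Gram coefficients within
  these bounds.\<close>

lemma card_presented_matrices:
  fixes B :: "nat \<Rightarrow> real"
  assumes B1: "\<And>i. i < r \<Longrightarrow> B i \<ge> 1"
    and K: "K \<ge> 1" and T: "T > 0"
  shows "finite (presented_matrices r B K T :: (int^'n::finite^'n) set)"
    and "real (card (presented_matrices r B K T :: (int^'n^'n) set)) * (\<Prod>(i, j)\<in>index_pairs r. B j / B i)
      \<le> (\<Prod>i<r. (3 * K * 2 ^ r * B i) ^ CARD('n)) *
         (\<Prod>(i, j)\<in>index_pairs r. 1 + 2 * real r ^ 2 * K * T / (B i * B j))"
proof -
  let ?A = "presented_matrices r B K T :: (int^'n^'n) set"
  let ?P = "index_pairs r"
  define V where "V = (\<lambda>i. {v::int^'n. \<forall>k. \<bar>real_of_int (v $ k)\<bar> \<le> K * 2 ^ r * B i})"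
  define W where "W = (\<lambda>p. {z::int. \<bar>real_of_int z\<bar> \<le> real r ^ 2 * K * T / (B (fst p) * B (snd p))})"
  \<comment> \<open>With the ceiling there are at least \<open>B j / B i\<close> coefficients, and
    each of them is still below this quotient.\<close>
  define M where "M = (\<lambda>p. {0..<\<lceil>B (snd p) / B (fst p)\<rceil>})"
  \<comment> \<open>Rebuilds a skew matrix from its entries above the diagonal, so that only pairs
    \<open>i < j\<close> are counted.\<close>
  define ext where "ext = (\<lambda>(Y::nat \<times> nat \<Rightarrow> int) i j. if i < j then Y (i, j) else if j < i then - Y (j, i) else 0)"
  define F where "F = (\<lambda>(b::nat \<Rightarrow> int^'n, Y). ((\<chi> k l. \<Sum>i<r. \<Sum>j<r. ext Y i j * b i $ k * b j $ l) :: int^'n^'n, b))"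
  define TS where "TS = PiE {..<r} V \<times> PiE ?P W"
  have pos: "B i > 0" if "i < r" for i using B1[OF that] by simp
  have finV: "finite (V i)" and cardV: "real (card (V i)) \<le> (3 * K * 2 ^ r * B i) ^ CARD('n)"
    if "i < r" for i
  proof -
    have 1: "1 \<le> K * 2 ^ r * B i"
    proof -
      have "1 * 1 * 1 \<le> K * 2 ^ r * B i" using K B1[OF that] by (intro mult_mono) auto
      then show ?thesis by simp
    qed
    show "finite (V i)" unfolding V_def using 1 by (intro card_int_vec_box_le) simp
    have "real (card (V i)) \<le> (2 * (K * 2 ^ r * B i) + 1) ^ CARD('n)"
      unfolding V_def using 1 by (intro card_int_vec_box_le) simp
    also have "\<dots> \<le> (3 * (K * 2 ^ r * B i)) ^ CARD('n)" using 1 by (intro power_mono) linarith+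
    finally show "real (card (V i)) \<le> (3 * K * 2 ^ r * B i) ^ CARD('n)" by (simp add: mult.assoc)
  qed
  have finW: "finite (W p)"
    and cardW: "real (card (W p)) \<le> (case p of (i, j) \<Rightarrow> 1 + 2 * real r ^ 2 * K * T / (B i * B j))"
    if "p \<in> ?P" for p
  proof -
    have 1: "0 \<le> real r ^ 2 * K * T / (B (fst p) * B (snd p))"
      using that K T pos[of "fst p"] pos[of "snd p"] by (auto simp: index_pairs_def)
    show "finite (W p)" unfolding W_def by (rule card_int_box_le[OF 1])
    show "real (card (W p)) \<le> (case p of (i, j) \<Rightarrow> 1 + 2 * real r ^ 2 * K * T / (B i * B j))"
      using card_int_box_le(2)[OF 1] unfolding W_def by (cases p) (simp add: mult.assoc add.commute)
  qed
  have finTS: "finite TS" unfolding TS_def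
    by (intro finite_cartesian_product finite_PiE finV finW) auto
  have cardM: "(case p of (i, j) \<Rightarrow> B j / B i) \<le> real (card (M p))" for p
    by (cases p) (simp add: M_def, linarith)
  have M_nonempty: "PiE ?P M \<noteq> {}"
  proof -
    have "0 \<in> M p" if "p \<in> ?P" for p
      using that pos[of "fst p"] pos[of "snd p"] by (auto simp: M_def index_pairs_def)
    then show ?thesis by (auto simp: PiE_eq_empty_iff)
  qed
  have "\<forall>A\<in>?A. \<exists>b c x. presentation r B K T A b c x"
    unfolding presented_matrices_def by blast
  then obtain b c x where "\<And>A. A \<in> ?A \<Longrightarrow> presentation r B K T A (b A) (c A) (x A)"
    by metis
  then have
        b: "\<And>A i k. A \<in> ?A \<Longrightarrow> i < r \<Longrightarrow> \<bar>real_of_int ((b A :: nat \<Rightarrow> int^'n) i $ k)\<bar> \<le> K * B i"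
    and dual: "\<And>A i j. A \<in> ?A \<Longrightarrow> i < r \<Longrightarrow> j < r \<Longrightarrow>
          (\<Sum>k\<in>UNIV. (c A :: nat \<Rightarrow> real^'n) i $ k * real_of_int (b A j $ k)) = (if i = j then 1 else 0)"
    and x: "\<And>A i j. A \<in> ?A \<Longrightarrow> i < r \<Longrightarrow> j < r \<Longrightarrow> \<bar>real_of_int (x A i j)\<bar> \<le> K * T / (B i * B j)"
    and skew: "\<And>A i j. A \<in> ?A \<Longrightarrow> i < r \<Longrightarrow> j < r \<Longrightarrow> x A i j = - x A j i"
    and A_eq: "\<And>A k l. A \<in> ?A \<Longrightarrow> A $ k $ l = (\<Sum>i<r. \<Sum>j<r. x A i j * b A i $ k * b A j $ l)"
    unfolding presentation_def by blast+
  \<comment> \<open>Since \<open>A\<close> is kept next to the new vectors, its chosen basis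
    \<open>b A\<close> is known and the new vectors determine \<open>m\<close>.\<close>
  define G where "G = (\<lambda>(A, m). (A :: int^'n^'n, restrict (unipotent_change m (b A)) {..<r}))"
  have inj: "inj_on G (?A \<times> PiE ?P M)"
  proof (rule inj_onI, clarify)
    fix A m A' m'
    assume A: "A \<in> ?A" "A' \<in> ?A" and m: "m \<in> PiE ?P M" "m' \<in> PiE ?P M" and eq: "G (A, m) = G (A', m')"
    then have [simp]: "A' = A" by (simp add: G_def)
    have "unipotent_change m (b A) j = unipotent_change m' (b A) j" if "j < r" for j
      using eq that by (auto simp: G_def fun_eq_iff restrict_def split: if_splits dest!: spec[of _ j])
    then have "m p = m' p" if "p \<in> ?P" for p
      using unipotent_change_inj[where c = "c A" and b = "b A" and r = r and m = m and m' = m'] dual A that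
      by (auto simp: index_pairs_def)
    then have "m = m'" using m by (rule PiE_ext[rotated 2])
    then show "A = A' \<and> m = m'" by simp
  qed
  \<comment> \<open>The pair of a matrix and a changed basis is also recovered from that basis and
    its Gram entries, all lying in boxes. Comparing the two descriptions is the double
    count.\<close>
  have sub: "G ` (?A \<times> PiE ?P M) \<subseteq> F ` TS"
  proof (rule image_subsetI, clarify)
    fix A m assume A: "A \<in> ?A" and m: "m \<in> PiE ?P M"
    have mbd: "\<bar>real_of_int (m (i, j))\<bar> \<le> B j / B i" if "i < j" "j < r" for i j
    proof -
      have "m (i, j) \<in> M (i, j)" using m that by (auto simp: index_pairs_def)
      then show ?thesis by (auto simp: M_def less_ceiling_iff)
    qed
    define b' where "b' = unipotent_change m (b A)"
    \<comment> \<open>The coefficients that express the old vectors through the new ones, read off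
      from the recursion.\<close>
    define u where "u = (\<lambda>i k. if i = k then 1 else if i < k then m (i, k) else 0)"
    have ubd: "\<bar>real_of_int (u i k)\<bar> \<le> B k / B i" if "i < r" "k < r" for i k
      using mbd[of i k] that pos[of i] pos[of k] by (auto simp: u_def)
    have bu: "b A k $ t = (\<Sum>i<r. u i k * b' i $ t)" if "k < r" for k t
    proof -
      have "(\<Sum>i<r. u i k * b' i $ t) = (\<Sum>i\<in>{..k}. u i k * b' i $ t)"
        using that by (intro sum.mono_neutral_right) (auto simp: u_def)
      also have "\<dots> = u k k * b' k $ t + (\<Sum>i<k. u i k * b' i $ t)"
        by (simp add: lessThan_Suc_atMost[symmetric])
      also have "(\<Sum>i<k. u i k * b' i $ t) = (\<Sum>i<k. m (i, k) * b' i $ t)"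
        by (intro sum.cong) (auto simp: u_def)
      finally show ?thesis
        using unipotent_change_component[of m "b A" k t] by (simp add: u_def b'_def)
    qed
    define x' where "x' = (\<lambda>i j. \<Sum>k<r. \<Sum>l<r. u i k * x A k l * u j l)"
    have x'skew: "x' i j = - x' j i" for i j
    proof -
      have "x' j i = (\<Sum>l<r. \<Sum>k<r. u j k * x A k l * u i l)" unfolding x'_def by (rule sum.swap)
      also have "\<dots> = (\<Sum>l<r. \<Sum>k<r. - (u i l * x A l k * u j k))"
      proof (intro sum.cong refl)
        fix l k assume "l \<in> {..<r}" "k \<in> {..<r}"
        then have eq: "x A k l = - x A l k" by (intro skew[OF A]) auto
        show "u j k * x A k l * u i l = - (u i l * x A l k * u j k)" by (subst eq) simp
      qed
      also have "\<dots> = - x' i j" by (simp add: x'_def sum_negf)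
      finally show ?thesis by simp
    qed
    \<comment> \<open>In each of the \<open>r ^ 2\<close> terms the sizes \<open>B k\<close> and
      \<open>B l\<close> cancel, leaving \<open>K * T / (B i * B j)\<close>.\<close>
    have x'bd: "\<bar>real_of_int (x' i j)\<bar> \<le> real r ^ 2 * K * T / (B i * B j)" if ij: "i < r" "j < r" for i j
    proof -
      have "\<bar>real_of_int (x' i j)\<bar> \<le> (\<Sum>k<r. \<Sum>l<r. \<bar>real_of_int (u i k * x A k l * u j l)\<bar>)"
        unfolding x'_def of_int_sum by (rule order_trans[OF sum_abs sum_mono[OF sum_abs]])
      also have "\<dots> \<le> (\<Sum>k<r. \<Sum>l<r. K * T / (B i * B j))"
      proof (intro sum_mono)
        fix k l assume "k \<in> {..<r}" "l \<in> {..<r}"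
        then have kl: "k < r" "l < r" by auto
        have "\<bar>real_of_int (u i k * x A k l * u j l)\<bar> \<le> (B k / B i) * (K * T / (B k * B l)) * (B l / B j)"
          unfolding of_int_mult abs_mult using ij kl K T pos
          by (intro mult_mono ubd x A) (auto simp: less_imp_le)
        also have "\<dots> = K * T / (B i * B j)" using pos[OF kl(1)] pos[OF kl(2)] by simp
        finally show "\<bar>real_of_int (u i k * x A k l * u j l)\<bar> \<le> K * T / (B i * B j)" .
      qed
      also have "\<dots> = real r ^ 2 * K * T / (B i * B j)" by (simp add: power2_eq_square)
      finally show ?thesis .
    qed
    define Y where "Y = restrict (\<lambda>(i, j). x' i j) ?P"
    have ext: "ext Y i j = x' i j" if "i < r" "j < r" for i j
      using x'skew[of i j] that by (auto simp: ext_def Y_def index_pairs_def)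
    have "A $ k $ l = (\<Sum>i<r. \<Sum>j<r. ext Y i j * b' i $ k * b' j $ l)" for k l
    proof -
      have "A $ k $ l = (\<Sum>i<r. \<Sum>j<r. x A i j * (\<Sum>s<r. u s i * b' s $ k) * (\<Sum>t<r. u t j * b' t $ l))"
        unfolding A_eq[OF A] by (intro sum.cong refl) (simp add: bu)
      also have "\<dots> = (\<Sum>i<r. \<Sum>j<r. x' i j * b' i $ k * b' j $ l)"
        unfolding x'_def by (rule bilinear_form_substitution)
      also have "\<dots> = (\<Sum>i<r. \<Sum>j<r. ext Y i j * b' i $ k * b' j $ l)"
        by (intro sum.cong refl) (simp add: ext)
      finally show ?thesis .
    qed
    then have "G (A, m) = F (restrict b' {..<r}, Y)"
      by (simp add: G_def F_def b'_def vec_eq_iff)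
    moreover have "restrict b' {..<r} \<in> PiE {..<r} V"
    proof -
      have "\<bar>real_of_int (b' i $ k)\<bar> \<le> K * 2 ^ r * B i" if "i < r" for i k
      proof -
        have "\<bar>real_of_int (b' i $ k)\<bar> \<le> K * 2 ^ i * B i"
          unfolding b'_def by (rule unipotent_change_bound[where r = r]) (use b[OF A] pos mbd that in auto)
        also have "\<dots> \<le> K * 2 ^ r * B i"
          using K that pos[OF that] by (intro mult_right_mono mult_left_mono power_increasing) auto
        finally show ?thesis .
      qed
      then show ?thesis by (auto simp: V_def)
    qed
    moreover have "Y \<in> PiE ?P W"
      using x'bd by (auto simp: Y_def W_def index_pairs_def)
    ultimately show "G (A, m) \<in> F ` TS" by (auto simp: TS_def)
  qed
  have finG: "finite (?A \<times> PiE ?P M)"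
    using inj sub finTS by (metis finite_imageD finite_imageI finite_subset)
  then show "finite ?A" using M_nonempty by (rule finite_cartesian_productD1)
  have "card (?A \<times> PiE ?P M) \<le> card (F ` TS)"
    using inj sub finTS by (intro card_inj_on_le) auto
  also have "\<dots> \<le> card TS" using finTS by (rule card_image_le)
  finally have le: "real (card ?A) * real (card (PiE ?P M)) \<le> real (card (PiE {..<r} V)) * real (card (PiE ?P W))"
    unfolding TS_def card_cartesian_product by (metis of_nat_le_iff of_nat_mult)
  have "real (card ?A) * (\<Prod>(i, j)\<in>?P. B j / B i) \<le> real (card ?A) * real (card (PiE ?P M))"
  proof (rule mult_left_mono)
    have "(\<Prod>(i, j)\<in>?P. B j / B i) \<le> (\<Prod>p\<in>?P. real (card (M p)))"
      using pos by (intro prod_mono conjI cardM) (auto simp: index_pairs_def less_imp_le)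
    then show "(\<Prod>(i, j)\<in>?P. B j / B i) \<le> real (card (PiE ?P M))" by (simp add: card_PiE)
  qed simp
  also note le
  also have "real (card (PiE {..<r} V)) * real (card (PiE ?P W)) \<le> (\<Prod>i<r. (3 * K * 2 ^ r * B i) ^ CARD('n)) *
         (\<Prod>(i, j)\<in>?P. 1 + 2 * real r ^ 2 * K * T / (B i * B j))"
  proof (rule mult_mono)
    show "real (card (PiE {..<r} V)) \<le> (\<Prod>i<r. (3 * K * 2 ^ r * B i) ^ CARD('n))"
      by (auto simp: card_PiE intro!: prod_mono cardV)
    show "real (card (PiE ?P W)) \<le> (\<Prod>(i, j)\<in>?P. 1 + 2 * real r ^ 2 * K * T / (B i * B j))"
      unfolding card_PiE[OF finite_index_pairs] of_nat_prod by (intro prod_mono conjI cardW) auto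
    show "0 \<le> (\<Prod>i<r. (3 * K * 2 ^ r * B i) ^ CARD('n))"
      using K pos by (intro prod_nonneg) (auto simp: less_imp_le)
  qed simp
  finally show "real (card ?A) * (\<Prod>(i, j)\<in>?P. B j / B i)
      \<le> (\<Prod>i<r. (3 * K * 2 ^ r * B i) ^ CARD('n)) *
         (\<Prod>(i, j)\<in>?P. 1 + 2 * real r ^ 2 * K * T / (B i * B j))" .
qed

section \<open>Presentation of alternating matrices by reduced bases\<close>

text \<open>A nonzero determinant has a nonzero term in its Leibniz expansion. The injection
  \<open>f\<close> places \<open>X\<close> inside a matrix indexed by \<open>'n\<close>, to which
  \<open>det\<close> applies.\<close>

lemma nonsingular_transversal:
  fixes X :: "nat \<Rightarrow> nat \<Rightarrow> real" and f :: "nat \<Rightarrow> 'n::finite"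
  assumes f: "inj_on f {..<r}"
    and ns: "\<And>w j. (\<And>i. i < r \<Longrightarrow> (\<Sum>j<r. X i j * w j) = 0) \<Longrightarrow> j < r \<Longrightarrow> w j = 0"
  shows "\<exists>\<pi>. bij_betw \<pi> {..<r} {..<r} \<and> (\<forall>i<r. X i (\<pi> i) \<noteq> 0)"
proof -
  define I where "I = f ` {..<r}"
  define g where "g = the_inv_into {..<r} f"
  have gf: "g (f i) = i" if "i < r" for i
    using the_inv_into_f_f[OF f] that by (simp add: g_def)
  have bij_f: "bij_betw f {..<r} I" using f by (simp add: bij_betw_def I_def)
  have bij_g: "bij_betw g I {..<r}" unfolding g_def by (rule bij_betw_the_inv_into[OF bij_f])
  \<comment> \<open>Padding by the identity outside \<open>I\<close> keeps the kernel trivial, and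
    the zero off-diagonal blocks force a permutation with nonzero entries to preserve
    \<open>I\<close>.\<close>
  define M :: "real^'n^'n"
    where "M = (\<chi> p q. if p \<in> I \<and> q \<in> I then X (g p) (g q) else if p = q then 1 else 0)"
  have "v = 0" if v: "M *v v = 0" for v
  proof -
    have out: "v $ p = 0" if "p \<notin> I" for p
    proof -
      have "(M *v v) $ p = (\<Sum>q\<in>UNIV. if q = p then v $ q else 0)"
        unfolding matrix_vector_mult_def vec_lambda_beta
        using that by (intro sum.cong) (auto simp: M_def)
      then show ?thesis using v by simp
    qed
    have eqs: "(\<Sum>j<r. X i j * v $ f j) = 0" if "i < r" for i
    proof -
      have fi: "f i \<in> I" using that by (simp add: I_def)
      have "0 = (M *v v) $ f i" using v by simp
      also have "\<dots> = (\<Sum>q\<in>I. M $ f i $ q * v $ q)"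
        unfolding matrix_vector_mult_def vec_lambda_beta
        by (rule sum.mono_neutral_right) (auto simp: out)
      also have "\<dots> = (\<Sum>j<r. M $ f i $ f j * v $ f j)"
        by (rule sum.reindex_bij_betw[OF bij_f, symmetric])
      also have "\<dots> = (\<Sum>j<r. X i j * v $ f j)"
        using that by (intro sum.cong) (auto simp: M_def I_def gf)
      finally show ?thesis by simp
    qed
    have "v $ f j = 0" if "j < r" for j
      by (rule ns[where w = "\<lambda>j. v $ f j"]) (use eqs that in auto)
    then have "v $ p = 0" for p using out[of p] by (cases "p \<in> I") (auto simp: I_def)
    then show ?thesis by (simp add: vec_eq_iff)
  qed
  then have "\<exists>B. B ** M = mat 1" by (simp add: matrix_left_invertible_ker)
  then have "invertible M" by (simp add: invertible_left_inverse)
  then have "det M \<noteq> 0" by (simp add: invertible_det_nz)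
  then obtain p where p: "p permutes UNIV" and "of_int (sign p) * (\<Prod>i\<in>UNIV. M $ i $ p i) \<noteq> 0"
    unfolding det_def by (metis (no_types, lifting) mem_Collect_eq sum.neutral)
  then have nz: "M $ i $ p i \<noteq> 0" for i by simp
  have pI: "p i \<in> I" if "i \<in> I" for i
    using nz[of i] that by (auto simp: M_def split: if_splits)
  have inj_p: "inj_on p I" using permutes_inj[OF p] by (rule inj_on_subset) simp
  have bij_p: "bij_betw p I I"
    using pI inj_p endo_inj_surj[of I p] by (auto simp: bij_betw_def)
  have "bij_betw (g \<circ> (p \<circ> f)) {..<r} {..<r}"
    by (intro bij_betw_trans[OF bij_betw_trans[OF bij_f bij_p] bij_g])
  moreover have "X i ((g \<circ> (p \<circ> f)) i) \<noteq> 0" if "i < r" for i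
  proof -
    have "f i \<in> I" using that by (simp add: I_def)
    then show ?thesis using nz[of "f i"] pI[of "f i"] by (simp add: M_def gf that)
  qed
  ultimately show ?thesis by blast
qed

lemma entry_le_frobenius_norm: "\<bar>real_of_int (A $ i $ j)\<bar> \<le> frobenius_norm A"
proof -
  have "(real_of_int (A $ i $ j))\<^sup>2 \<le> (\<Sum>j\<in>UNIV. (real_of_int (A $ i $ j))\<^sup>2)"
    by (rule member_le_sum) auto
  also have "\<dots> \<le> (\<Sum>i\<in>UNIV. \<Sum>j\<in>UNIV. (real_of_int (A $ i $ j))\<^sup>2)"
    by (rule member_le_sum[where f = "\<lambda>i. \<Sum>j\<in>UNIV. (real_of_int (A $ i $ j))\<^sup>2"])
      (auto intro: sum_nonneg)
  finally show ?thesis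
    unfolding frobenius_norm_def by (metis real_sqrt_abs real_sqrt_le_mono)
qed

text \<open>Pairing a linear relation with \<open>c i\<close> isolates its coefficient at
  \<open>b i\<close>, so the vectors \<open>b i\<close> are independent and form a basis of the
  range.\<close>

lemma rank_eq_dual_basis:
  fixes A :: "real^'n^'m" and b c :: "nat \<Rightarrow> real^'m"
  assumes b: "\<And>i. i < r \<Longrightarrow> b i \<in> range ((*v) A)"
    and dual: "\<And>i j. i < r \<Longrightarrow> j < r \<Longrightarrow> inner (c i) (b j) = (if i = j then 1 else 0)"
    and span: "range ((*v) A) \<subseteq> span (b ` {..<r})"
  shows "rank A = r"
proof -
  have inj: "inj_on b {..<r}"
  proof (rule inj_onI)
    fix i j assume "i \<in> {..<r}" "j \<in> {..<r}" "b i = b j"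
    then show "i = j" using dual[of i i] dual[of i j] by (auto split: if_splits)
  qed
  have "independent (b ` {..<r})"
  proof
    assume "dependent (b ` {..<r})"
    then obtain u i where i: "i < r" "u (b i) \<noteq> 0" and u: "(\<Sum>v\<in>b ` {..<r}. u v *\<^sub>R v) = 0"
      by (auto simp: dependent_finite)
    have "0 = inner (c i) (\<Sum>v\<in>b ` {..<r}. u v *\<^sub>R v)" by (simp add: u)
    also have "\<dots> = (\<Sum>j<r. u (b j) * inner (c i) (b j))"
      by (simp add: sum.reindex[OF inj] inner_sum_right)
    also have "\<dots> = (\<Sum>j<r. if j = i then u (b j) else 0)"
      using i by (intro sum.cong) (auto simp: dual)
    also have "\<dots> = u (b i)" using i by simp
    finally show False using i by simp
  qed
  then have "dim (range ((*v) A)) = card (b ` {..<r})"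
    using b span by (intro dim_unique) auto
  then show ?thesis using inj by (simp add: rank_dim_range card_image)
qed

text \<open>The primitive lattice \<open>L\<close> of integer vectors in the range of the matrix is used, since
  then the Gram coefficients \<open>inner (c i) (R *v c j)\<close> are integers.\<close>

lemma presentation_exists:
  "\<exists>K\<ge>1. \<forall>(A::int^'n::finite^'n) T. alternating_matrix A \<longrightarrow> frobenius_norm A < T \<longrightarrow>
    (\<exists>\<kappa>::nat \<Rightarrow> nat.
      (\<forall>i j. i \<le> j \<longrightarrow> j < rank (map_matrix real_of_int A) \<longrightarrow> \<kappa> i \<le> \<kappa> j) \<and>
      A \<in> presented_matrices (rank (map_matrix real_of_int A)) (\<lambda>i. 2 ^ \<kappa> i) K T \<and>
      (\<Prod>i<rank (map_matrix real_of_int A). 2 ^ \<kappa> i)\<^sup>2 \<le> (K * T) ^ rank (map_matrix real_of_int A))"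
proof -
  obtain C where C: "C \<ge> 1" and red: "\<And>(S::'n set) (L::(real^'n) set) N d. card S \<le> CARD('n) \<Longrightarrow> additive_subgroup L \<Longrightarrow> N \<noteq> 0 \<Longrightarrow>
     (\<forall>v\<in>L. \<forall>k. N * v $ k \<in> \<int>) \<Longrightarrow> (\<forall>v\<in>L. \<forall>k. k \<notin> S \<longrightarrow> v $ k = 0) \<Longrightarrow> 0 < d \<Longrightarrow>
     (\<forall>v\<in>L. v \<noteq> 0 \<longrightarrow> d \<le> sup_norm v) \<Longrightarrow>
     (\<exists>r b c \<beta>. r \<le> CARD('n) \<and> reduced_basis C d L r b c \<beta>)"
    using reduced_basis_exists[where 'n = 'n and s = "CARD('n)"] by blast
  \<comment> \<open>Each of the two dual vectors in a Gram coefficient contributes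
    \<open>2 * C\<close>; the 2 comes from rounding sizes up to powers of two.\<close>
  define K where "K = 4 * C\<^sup>2"
  have KC: "C \<le> K"
  proof -
    have "C * 1 \<le> C * (4 * C)" using C by (intro mult_left_mono) auto
    then show ?thesis by (simp add: K_def power2_eq_square mult_ac)
  qed
  have K: "K \<ge> 1" using KC C by simp
  have "\<exists>\<kappa>::nat \<Rightarrow> nat.
      (\<forall>i j. i \<le> j \<longrightarrow> j < rank (map_matrix real_of_int A) \<longrightarrow> \<kappa> i \<le> \<kappa> j) \<and>
      A \<in> presented_matrices (rank (map_matrix real_of_int A)) (\<lambda>i. 2 ^ \<kappa> i) K T \<and>
      (\<Prod>i<rank (map_matrix real_of_int A). 2 ^ \<kappa> i)\<^sup>2 \<le> (K * T) ^ rank (map_matrix real_of_int A)"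
    if alt: "alternating_matrix A" and AT: "frobenius_norm A < T" for A :: "int^'n^'n" and T
  proof -
    define R where "R = map_matrix real_of_int A"
    have Rint: "R $ k $ l \<in> \<int>" for k l by (simp add: R_def)
    have RT: "\<bar>R $ k $ l\<bar> \<le> T" for k l
      using entry_le_frobenius_norm[of A k l] AT by (simp add: R_def)
    have T: "T > 0"
    proof -
      have "frobenius_norm A \<ge> 0" by (auto simp: frobenius_norm_def intro!: sum_nonneg)
      then show ?thesis using AT by simp
    qed
    have Rskew: "transpose R = - R"
    proof -
      have "transpose R = map_matrix real_of_int (transpose A)"
        by (simp add: R_def transpose_def vec_eq_iff)
      also have "transpose A = - A" using alt by (simp add: alternating_matrix_def)
      finally show ?thesis by (simp add: R_def vec_eq_iff)
    qed
    \<comment> \<open>Skewness in adjoint form. It yields the skewness of \<open>X\<close>, the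
      integrality of \<open>R *v c i\<close>, and the orthogonality of kernel and range.\<close>
    have adj: "inner u (R *v v) = - inner v (R *v u)" for u v
    proof -
      have "inner u (R *v v) = inner (u v* R) v" by (simp add: dot_lmul_matrix)
      also have "u v* R = transpose R *v u" by simp
      also have "\<dots> = - (R *v u)" unfolding Rskew
        by (simp add: matrix_vector_mult_def vec_eq_iff sum_negf)
      finally show ?thesis by (simp add: inner_commute)
    qed
    define L where "L = {v. (\<forall>k. v $ k \<in> \<int>) \<and> v \<in> range ((*v) R)}"
    have L: "additive_subgroup L"
      unfolding additive_subgroup_def
    proof (intro conjI ballI)
      show "0 \<in> L" by (auto simp: L_def intro!: image_eqI[of _ _ 0])
      fix x y assume "x \<in> L" "y \<in> L"
      then show "x - y \<in> L"
        by (auto simp: L_def simp flip: matrix_vector_mult_diff_distrib)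
    qed
    have L1: "1 \<le> sup_norm v" if v: "v \<in> L" "v \<noteq> 0" for v
    proof -
      obtain k where "v $ k \<noteq> 0" using v by (auto simp: vec_eq_iff)
      moreover have "v $ k \<in> \<int>" using that by (simp add: L_def)
      ultimately have "1 \<le> \<bar>v $ k\<bar>" by (simp add: Ints_nonzero_abs_ge1)
      then show ?thesis using component_le_sup_norm[of v k] by linarith
    qed
    have Lint: "\<forall>v\<in>L. \<forall>k. 1 * v $ k \<in> \<int>" by (simp add: L_def)
    have "\<exists>r b c \<beta>. r \<le> CARD('n) \<and> reduced_basis C 1 L r b c \<beta>"
      by (rule red[OF _ L _ Lint, of UNIV]) (simp_all add: L1)
    then obtain r b c \<beta> where r: "r \<le> CARD('n)" and basis: "reduced_basis C 1 L r b c \<beta>"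
      by blast
    have bL: "\<And>i. i < r \<Longrightarrow> b i \<in> L"
      and comb: "\<And>v. v \<in> L \<Longrightarrow> \<exists>m::nat \<Rightarrow> int. v = (\<Sum>i<r. real_of_int (m i) *\<^sub>R b i)"
      and dual: "\<And>i j. i < r \<Longrightarrow> j < r \<Longrightarrow> inner (c i) (b j) = (if i = j then 1 else 0)"
      and \<beta>1: "\<And>i. i < r \<Longrightarrow> 1 \<le> \<beta> i" and \<beta>mono: "\<And>i j. i \<le> j \<Longrightarrow> j < r \<Longrightarrow> \<beta> i \<le> \<beta> j"
      and bbd: "\<And>i k. i < r \<Longrightarrow> \<bar>b i $ k\<bar> \<le> C * \<beta> i"
      and cbd: "\<And>i. i < r \<Longrightarrow> (\<Sum>k\<in>UNIV. \<bar>c i $ k\<bar>) * \<beta> i \<le> C"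
      using basis unfolding reduced_basis_def by blast+
    have expand_L: "v = (\<Sum>j<r. inner (c j) v *\<^sub>R b j)" and coeff_int: "\<And>j. j < r \<Longrightarrow> inner (c j) v \<in> \<int>"
      if v: "v \<in> L" for v
    proof -
      obtain m :: "nat \<Rightarrow> int" where m: "v = (\<Sum>i<r. real_of_int (m i) *\<^sub>R b i)" using comb v by blast
      have cm: "inner (c j) v = m j" if "j < r" for j
      proof -
        have "inner (c j) v = (\<Sum>i<r. m i * inner (c j) (b i))" by (simp add: m inner_sum_right)
        also have "\<dots> = (\<Sum>i<r. if i = j then real_of_int (m i) else 0)"
          using that by (intro sum.cong) (auto simp: dual)
        finally show ?thesis using that by simp
      qed
      show "v = (\<Sum>j<r. inner (c j) v *\<^sub>R b j)" using m cm by simp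
      show "inner (c j) v \<in> \<int>" if "j < r" for j using cm that by simp
    qed
    have col: "R *v axis l 1 = column l R" for l by (rule matrix_vector_mult_basis)
    have colL: "R *v axis l 1 \<in> L" for l
      by (auto simp: L_def) (simp add: col column_def Rint)
    \<comment> \<open>The columns of \<open>R\<close> lie in \<open>L\<close>, so the expansion
      known on \<open>L\<close> extends linearly to the whole real range.\<close>
    have expand: "R *v u = (\<Sum>j<r. inner (c j) (R *v u) *\<^sub>R b j)" for u
    proof -
      have u: "R *v u = (\<Sum>l\<in>UNIV. u $ l *\<^sub>R (R *v axis l 1))"
        unfolding col by (simp add: matrix_mult_sum scalar_mult_eq_scaleR)
      also have "\<dots> = (\<Sum>l\<in>UNIV. u $ l *\<^sub>R (\<Sum>j<r. inner (c j) (R *v axis l 1) *\<^sub>R b j))"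
        by (intro sum.cong refl arg_cong2[where f = scaleR] expand_L[OF colL])
      also have "\<dots> = (\<Sum>j<r. inner (c j) (\<Sum>l\<in>UNIV. u $ l *\<^sub>R (R *v axis l 1)) *\<^sub>R b j)"
        unfolding scaleR_sum_right inner_sum_right scaleR_sum_left by (subst sum.swap) simp
      finally show ?thesis unfolding u[symmetric] .
    qed
    have rank: "rank R = r"
    proof (rule rank_eq_dual_basis[where c = c])
      show "b i \<in> range ((*v) R)" if "i < r" for i using bL[OF that] by (simp add: L_def)
      show "range ((*v) R) \<subseteq> span (b ` {..<r})"
      proof clarify
        fix u
        show "R *v u \<in> span (b ` {..<r})"
          by (subst expand) (auto intro: span_sum span_scale span_base)
      qed
    qed (use dual in auto)
    define X where "X = (\<lambda>i j. inner (c i) (R *v c j))"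
    \<comment> \<open>By skewness, entry \<open>k\<close> of \<open>R *v c i\<close> is up to sign
      the coefficient at \<open>b i\<close> of column \<open>k\<close>, a vector of
      \<open>L\<close>.\<close>
    have yL: "R *v c i \<in> L" if "i < r" for i
    proof -
      have "(R *v c i) $ k \<in> \<int>" for k
      proof -
        have "(R *v c i) $ k = inner (axis k 1) (R *v c i)" by (simp add: inner_axis')
        also have "\<dots> = - inner (c i) (R *v axis k 1)" by (rule adj)
        finally show ?thesis using coeff_int[OF colL that] by simp
      qed
      then show ?thesis by (simp add: L_def)
    qed
    have Xint: "X i j \<in> \<int>" if "i < r" "j < r" for i j
      unfolding X_def using that by (intro coeff_int yL)
    have Xskew: "X i j = - X j i" for i j unfolding X_def by (rule adj)
    have R_eq: "R $ k $ l = (\<Sum>i<r. \<Sum>j<r. X i j * b i $ k * b j $ l)" for k l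
    proof -
      have "R $ k $ l = (R *v axis l 1) $ k" by (simp add: col column_def)
      also have "\<dots> = (\<Sum>i<r. inner (c i) (R *v axis l 1) * b i $ k)"
        using arg_cong[OF expand_L[OF colL], of "\<lambda>v. v $ k"] by simp
      also have "\<dots> = (\<Sum>i<r. (\<Sum>j<r. X i j * b j $ l) * b i $ k)"
      proof (intro sum.cong refl)
        fix i assume "i \<in> {..<r}"
        have "inner (c i) (R *v axis l 1) = - inner (axis l 1) (R *v c i)" by (rule adj)
        also have "\<dots> = - ((R *v c i) $ l)" by (simp add: inner_axis')
        also have "(R *v c i) $ l = (\<Sum>j<r. X j i * b j $ l)"
          using arg_cong[OF expand, of "\<lambda>v. v $ l"] by (simp add: X_def)
        also have "- (\<Sum>j<r. X j i * b j $ l) = (\<Sum>j<r. X i j * b j $ l)"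
          by (subst Xskew) (simp add: sum_negf)
        finally show "inner (c i) (R *v axis l 1) * b i $ k = (\<Sum>j<r. X i j * b j $ l) * b i $ k" by simp
      qed
      also have "\<dots> = (\<Sum>i<r. \<Sum>j<r. X i j * b i $ k * b j $ l)"
        by (simp add: sum_distrib_left sum_distrib_right mult_ac)
      finally show ?thesis .
    qed
    \<comment> \<open>Sizes are rounded up to powers of two. As \<open>1 \<le> \<beta> i\<close>,
      the logarithm is nonnegative and \<open>nat\<close> truncates nothing.\<close>
    define \<kappa> where "\<kappa> = (\<lambda>i. nat \<lceil>log 2 (\<beta> i)\<rceil>)"
    have \<kappa>: "\<beta> i \<le> 2 ^ \<kappa> i" "2 ^ \<kappa> i \<le> 2 * \<beta> i" if "i < r" for i
    proof -
      have l0: "0 \<le> log 2 (\<beta> i)" using \<beta>1[OF that] by simp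
      have pw: "(2::real) ^ \<kappa> i = 2 powr real (\<kappa> i)" by (simp add: powr_realpow)
      have \<beta>p: "\<beta> i = 2 powr log 2 (\<beta> i)" using \<beta>1[OF that] by simp
      have "log 2 (\<beta> i) \<le> real (\<kappa> i)" using l0 by (simp add: \<kappa>_def)
      then have "2 powr log 2 (\<beta> i) \<le> 2 powr real (\<kappa> i)" by simp
      then show "\<beta> i \<le> 2 ^ \<kappa> i" using \<beta>p pw by simp
      have "real (\<kappa> i) \<le> log 2 (\<beta> i) + 1" using l0 by (simp add: \<kappa>_def)
      then have "2 powr real (\<kappa> i) \<le> 2 powr (log 2 (\<beta> i) + 1)" by simp
      also have "\<dots> = 2 * \<beta> i" using \<beta>p by (simp add: powr_add)
      finally show "2 ^ \<kappa> i \<le> 2 * \<beta> i" using pw by simp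
    qed
    have \<kappa>mono: "\<kappa> i \<le> \<kappa> j" if "i \<le> j" "j < r" for i j
      using \<beta>mono[OF that] \<beta>1[of i] that unfolding \<kappa>_def
      by (intro nat_mono ceiling_mono) simp
    have cB: "(\<Sum>k\<in>UNIV. \<bar>c i $ k\<bar>) \<le> 2 * C / 2 ^ \<kappa> i" if "i < r" for i
    proof -
      have "(\<Sum>k\<in>UNIV. \<bar>c i $ k\<bar>) * 2 ^ \<kappa> i \<le> (\<Sum>k\<in>UNIV. \<bar>c i $ k\<bar>) * (2 * \<beta> i)"
        using \<kappa>(2)[OF that] by (intro mult_left_mono sum_nonneg) auto
      also have "\<dots> \<le> 2 * C" using cbd[OF that] by (simp add: mult_ac)
      finally show ?thesis by (simp add: le_divide_eq)
    qed
    have Xbd: "\<bar>X i j\<bar> \<le> K * T / (2 ^ \<kappa> i * 2 ^ \<kappa> j)" if "i < r" "j < r" for i j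
    proof -
      have 1: "\<bar>(R *v c j) $ k\<bar> \<le> T * (\<Sum>k\<in>UNIV. \<bar>c j $ k\<bar>)" for k
        unfolding matrix_vector_mult_def vec_lambda_beta sum_distrib_left
        by (rule order_trans[OF sum_abs]) (auto simp: abs_mult intro!: sum_mono mult_right_mono RT)
      have "\<bar>X i j\<bar> \<le> (\<Sum>k\<in>UNIV. \<bar>c i $ k\<bar> * \<bar>(R *v c j) $ k\<bar>)"
        unfolding X_def inner_vec_def by (rule order_trans[OF sum_abs]) (simp add: abs_mult)
      also have "\<dots> \<le> (\<Sum>k\<in>UNIV. \<bar>c i $ k\<bar> * (T * (\<Sum>k\<in>UNIV. \<bar>c j $ k\<bar>)))"
        by (intro sum_mono mult_left_mono 1) auto
      also have "\<dots> = (\<Sum>k\<in>UNIV. \<bar>c i $ k\<bar>) * (T * (\<Sum>k\<in>UNIV. \<bar>c j $ k\<bar>))"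
        by (simp add: sum_distrib_right)
      also have "\<dots> \<le> (2 * C / 2 ^ \<kappa> i) * (T * (2 * C / 2 ^ \<kappa> j))"
        using C T that by (intro mult_mono cB mult_left_mono mult_nonneg_nonneg sum_nonneg) auto
      also have "\<dots> = K * T / (2 ^ \<kappa> i * 2 ^ \<kappa> j)" by (simp add: K_def power2_eq_square)
      finally show ?thesis .
    qed
    define bi :: "nat \<Rightarrow> int^'n" where "bi = (\<lambda>i. \<chi> k. \<lfloor>b i $ k\<rfloor>)"
    define xi :: "nat \<Rightarrow> nat \<Rightarrow> int" where "xi = (\<lambda>i j. \<lfloor>X i j\<rfloor>)"
    have bi: "real_of_int (bi i $ k) = b i $ k" if "i < r" for i k
      using bL[OF that] by (simp add: bi_def L_def)
    have xi: "real_of_int (xi i j) = X i j" if "i < r" "j < r" for i j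
      using Xint[OF that] by (simp add: xi_def)
    have "presentation r (\<lambda>i. 2 ^ \<kappa> i) K T A bi c xi"
      unfolding presentation_def
    proof (intro conjI allI impI)
      fix i k assume i: "i < r"
      have "\<bar>b i $ k\<bar> \<le> C * \<beta> i" using bbd i by simp
      also have "\<dots> \<le> K * 2 ^ \<kappa> i" using KC C \<kappa>(1)[OF i] \<beta>1[OF i] by (intro mult_mono) auto
      finally show "\<bar>real_of_int (bi i $ k)\<bar> \<le> K * 2 ^ \<kappa> i" using bi i by simp
    next
      fix i j assume ij: "i < r" "j < r"
      show "(\<Sum>k\<in>UNIV. c i $ k * real_of_int (bi j $ k)) = (if i = j then 1 else 0)"
        using dual[OF ij] ij by (simp add: bi inner_vec_def)
      show "\<bar>real_of_int (xi i j)\<bar> \<le> K * T / (2 ^ \<kappa> i * 2 ^ \<kappa> j)"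
        using Xbd ij by (simp add: xi)
      have "real_of_int (xi i j) = real_of_int (- xi j i)"
        using Xskew[of i j] ij xi[of i j] xi[of j i] by simp
      then show "xi i j = - xi j i" by (simp only: of_int_eq_iff)
    next
      fix k l
      have "real_of_int (A $ k $ l) = R $ k $ l" by (simp add: R_def)
      also have "\<dots> = real_of_int (\<Sum>i<r. \<Sum>j<r. xi i j * bi i $ k * bi j $ l)"
        unfolding R_eq by (simp add: xi bi)
      finally show "A $ k $ l = (\<Sum>i<r. \<Sum>j<r. xi i j * bi i $ k * bi j $ l)"
        by (simp only: of_int_eq_iff)
    qed
    then have pres: "A \<in> presented_matrices r (\<lambda>i. 2 ^ \<kappa> i) K T"
      unfolding presented_matrices_def by blast
    have "card {..<r} \<le> card (UNIV :: 'n set)" using r by simp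
    then obtain f :: "nat \<Rightarrow> 'n" where f: "inj_on f {..<r}"
      using card_le_inj[of "{..<r}" "UNIV :: 'n set"] by auto
    \<comment> \<open>A kernel vector \<open>w\<close> of \<open>X\<close> gives \<open>u\<close>
      with \<open>R *v u = 0\<close>. Then \<open>u\<close> is orthogonal to the range of
      \<open>R\<close>, in particular to \<open>b j\<close>, and that pairing equals
      \<open>w j\<close>.\<close>
    have ns: "w j = 0" if w: "\<And>i. i < r \<Longrightarrow> (\<Sum>j<r. X i j * w j) = 0" and j: "j < r" for w j
    proof -
      define u where "u = (\<Sum>j<r. w j *\<^sub>R c j)"
      have Ru: "R *v u = (\<Sum>j<r. w j *\<^sub>R (R *v c j))"
        by (simp add: u_def linear_sum[OF matrix_vector_mul_linear] matrix_vector_mult_scaleR)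
      have "inner (c i) (R *v u) = 0" if "i < r" for i
        using w[OF that] unfolding Ru inner_sum_right by (simp add: X_def mult.commute)
      then have Ru0: "R *v u = 0" by (subst expand) simp
      obtain z where z: "b j = R *v z" using bL[OF j] by (auto simp: L_def)
      have "inner u (b j) = - inner z (R *v u)" unfolding z by (rule adj)
      then have "inner u (b j) = 0" by (simp add: Ru0)
      moreover have "inner u (b j) = (\<Sum>i<r. if i = j then w i else 0)"
        unfolding u_def inner_sum_left using j by (intro sum.cong) (auto simp: dual)
      ultimately show ?thesis using j by simp
    qed
    obtain \<pi> where \<pi>: "bij_betw \<pi> {..<r} {..<r}" and nz: "\<And>i. i < r \<Longrightarrow> X i (\<pi> i) \<noteq> 0"
      using nonsingular_transversal[OF f, of X] ns by blast
    \<comment> \<open>A nonzero integer \<open>X i (\<pi> i)\<close> has absolute value at least 1,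
      so its upper bound limits the product of two sizes. Over the permutation every size occurs
      twice, hence the square below.\<close>
    have step: "2 ^ \<kappa> i * 2 ^ \<kappa> (\<pi> i) \<le> K * T" if "i < r" for i
    proof -
      have \<pi>i: "\<pi> i < r" using \<pi> that by (auto simp: bij_betw_def)
      have "1 \<le> \<bar>X i (\<pi> i)\<bar>" using Xint[OF that \<pi>i] nz[OF that] by (rule Ints_nonzero_abs_ge1)
      also have "\<dots> \<le> K * T / (2 ^ \<kappa> i * 2 ^ \<kappa> (\<pi> i))" using Xbd that \<pi>i by blast
      finally show ?thesis by (simp add: le_divide_eq)
    qed
    have "(\<Prod>i<r. 2 ^ \<kappa> i)\<^sup>2 = (\<Prod>i<r. 2 ^ \<kappa> i) * (\<Prod>i<r. (2::real) ^ \<kappa> (\<pi> i))"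
      using prod.reindex_bij_betw[OF \<pi>, of "\<lambda>i. (2::real) ^ \<kappa> i"] by (simp add: power2_eq_square)
    also have "\<dots> = (\<Prod>i<r. 2 ^ \<kappa> i * 2 ^ \<kappa> (\<pi> i))" by (simp add: prod.distrib)
    also have "\<dots> \<le> (\<Prod>i<r. K * T)" using step by (intro prod_mono) auto
    also have "\<dots> = (K * T) ^ r" by simp
    finally have "(\<Prod>i<r. 2 ^ \<kappa> i)\<^sup>2 \<le> (K * T) ^ r" .
    then show ?thesis using pres \<kappa>mono rank by (intro exI[of _ \<kappa>]) (simp add: R_def)
  qed
  then show ?thesis using K by (intro exI[of _ K]) blast
qed

section \<open>Summation over dyadic sizes\<close>

lemma sum_index_pairs: "(\<Sum>(i, j)\<in>index_pairs r. f i j) = (\<Sum>j<r. \<Sum>i<j. f i j)"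
proof -
  have "(\<Sum>j<r. \<Sum>i<j. f i j) = (\<Sum>(j, i)\<in>(SIGMA j:{..<r}. {..<j}). f i j)"
    by (rule sum.Sigma) auto
  also have "\<dots> = (\<Sum>(i, j)\<in>index_pairs r. f i j)"
    by (rule sum.reindex_bij_witness[of _ prod.swap prod.swap]) (auto simp: index_pairs_def)
  finally show ?thesis by simp
qed

text \<open>A form of Chebyshev's sum inequality: the weights \<open>2 * j\<close> increase along
  with \<open>x\<close>, and their mean over \<open>j < k\<close> is \<open>k - 1\<close>.\<close>

lemma sum_mult_index_ge:
  fixes x :: "nat \<Rightarrow> real"
  assumes "\<And>i j. i \<le> j \<Longrightarrow> j < k \<Longrightarrow> x i \<le> x j"
  shows "(real k - 1) * (\<Sum>j<k. x j) \<le> (\<Sum>j<k. 2 * real j * x j)"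
  using assms
proof (induction k)
  case (Suc k)
  have "(\<Sum>j<k. x j) \<le> (\<Sum>j<k. x k)" using Suc.prems by (intro sum_mono) auto
  then have "(\<Sum>j<k. x j) \<le> real k * x k" by simp
  moreover have "(real k - 1) * (\<Sum>j<k. x j) \<le> (\<Sum>j<k. 2 * real j * x j)"
    using Suc by auto
  ultimately show ?case by (simp add: algebra_simps)
qed simp

text \<open>With \<open>x i = ln (B i / sqrt T)\<close> the left-hand side is the logarithm of the bound of
  \<open>card_presented_matrices\<close> divided by \<open>T powr (n * r / 2)\<close>, up to constants.\<close>

lemma exponent_inequality:
  fixes x :: "nat \<Rightarrow> real"
  assumes mono: "\<And>i j. i \<le> j \<Longrightarrow> j < r \<Longrightarrow> x i \<le> x j"
    and D: "(\<Sum>i<r. x i) \<le> D" "0 \<le> D" and "r < n"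
  shows "real n * (\<Sum>i<r. x i) + (\<Sum>(i, j)\<in>index_pairs r. max (x i - x j) (- 2 * x j))
      \<le> (real n + 1) * D - (\<Sum>i<r. \<bar>x i\<bar>) / 2"
proof -
  \<comment> \<open>By monotonicity \<open>x\<close> is negative exactly below \<open>k\<close>; the
    alternative \<open>i = r\<close> covers the case where all values are negative.\<close>
  define k where "k = (LEAST i. i = r \<or> x i \<ge> 0)"
  have kr: "k \<le> r" unfolding k_def by (rule Least_le) simp
  have neg: "x i < 0" if "i < k" for i
    using not_less_Least[of i "\<lambda>i. i = r \<or> x i \<ge> 0"] that by (auto simp: k_def)
  have "k = r \<or> x k \<ge> 0" unfolding k_def by (rule LeastI[of _ r]) simp
  then have nonneg: "x i \<ge> 0" if "k \<le> i" "i < r" for i using mono[of k i] that by auto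
  define P where "P = (\<Sum>j<k. x j)"
  define Q where "Q = (\<Sum>j=k..<r. x j)"
  have split: "(\<Sum>j<r. h j) = (\<Sum>j<k. h j) + (\<Sum>j=k..<r. h j)" for h :: "nat \<Rightarrow> real"
    using sum.atLeastLessThan_concat[of 0 k r h] kr by (simp add: lessThan_atLeast0)
  \<comment> \<open>For \<open>j < k\<close> the second entry dominates the maximum. For
    \<open>j \<ge> k\<close> the maximum is at most \<open>- x j\<close> for the \<open>k\<close>
    negative \<open>x i\<close>, and at most 0 for the others.\<close>
  have row: "(\<Sum>i<j. max (x i - x j) (- 2 * x j)) \<le> (if j < k then - (2 * real j * x j) else - (real k * x j))"
    if j: "j < r" for j
  proof (cases "j < k")
    case True
    have "(\<Sum>i<j. max (x i - x j) (- 2 * x j)) \<le> (\<Sum>i<j. - 2 * x j)"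
    proof (rule sum_mono)
      fix i assume "i \<in> {..<j}"
      then show "max (x i - x j) (- 2 * x j) \<le> - 2 * x j"
        using mono[of i j] j neg[OF True] by auto
    qed
    then show ?thesis using True by simp
  next
    case False
    have "(\<Sum>i<j. max (x i - x j) (- 2 * x j)) \<le> (\<Sum>i<j. if i < k then - x j else 0)"
    proof (rule sum_mono)
      fix i assume "i \<in> {..<j}"
      then show "max (x i - x j) (- 2 * x j) \<le> (if i < k then - x j else 0)"
        using mono[of i j] j neg[of i] nonneg[of j] False by auto
    qed
    also have "\<dots> = (\<Sum>i<k. - x j)"
      using False by (intro sum.mono_neutral_cong_right) auto
    finally show ?thesis using False by simp
  qed
  have "(\<Sum>(i, j)\<in>index_pairs r. max (x i - x j) (- 2 * x j))
      \<le> (\<Sum>j<r. if j < k then - (2 * real j * x j) else - (real k * x j))"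
    unfolding sum_index_pairs by (intro sum_mono row) auto
  also have "\<dots> = - (\<Sum>j<k. 2 * real j * x j) - real k * Q"
    by (simp add: split Q_def sum_negf sum_distrib_left)
  also have "\<dots> \<le> - ((real k - 1) * P) - real k * Q"
    using sum_mult_index_ge[of k x] mono kr by (auto simp: P_def)
  finally have 1: "(\<Sum>(i, j)\<in>index_pairs r. max (x i - x j) (- 2 * x j)) \<le> - ((real k - 1) * P) - real k * Q" .
  have "(\<Sum>j<k. \<bar>x j\<bar>) = - P" unfolding P_def sum_negf[symmetric]
    by (rule sum.cong) (use neg in \<open>auto simp: less_imp_le abs_of_neg\<close>)
  moreover have "(\<Sum>j=k..<r. \<bar>x j\<bar>) = Q" unfolding Q_def
    by (rule sum.cong) (use nonneg in auto)
  ultimately have abs: "(\<Sum>i<r. \<bar>x i\<bar>) = Q - P" by (simp add: split)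
  have tot: "(\<Sum>i<r. x i) = P + Q" by (simp add: split P_def Q_def)
  \<comment> \<open>Moving \<open>(Q - P) / 2\<close> to the left gives \<open>P\<close> and
    \<open>Q\<close> the same coefficient \<open>n - k + 1/2\<close>, positive as
    \<open>k \<le> r < n\<close>, so the bound on the total sum applies.\<close>
  have "(real n - real k + 1/2) * (P + Q) \<le> (real n - real k + 1/2) * D"
    using D(1) tot kr \<open>r < n\<close> by (intro mult_left_mono) auto
  also have "\<dots> \<le> (real n + 1) * D" using D(2) by (intro mult_right_mono) auto
  finally have "(real n - real k + 1/2) * (P + Q) \<le> (real n + 1) * D" .
  then show ?thesis using 1 unfolding abs tot
    by (simp add: algebra_simps add_divide_distrib diff_divide_distrib)
qed

section \<open>Geometric sums\<close>

lemma sum_power_le: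
  fixes q :: real
  assumes "0 \<le> q" "q < 1"
  shows "(\<Sum>i<N. q ^ i) \<le> 1 / (1 - q)"
proof -
  have "(\<Sum>i<N. q ^ i) = (1 - q ^ N) / (1 - q)" using assms by (simp add: sum_gp_strict)
  also have "\<dots> \<le> 1 / (1 - q)" using assms by (intro divide_right_mono) auto
  finally show ?thesis .
qed

text \<open>Split at \<open>m\<close>, the integer part of \<open>u / a\<close>: on either side the
  terms are dominated by powers of \<open>exp (- a / 2)\<close>, wherever \<open>u\<close>
  lies.\<close>

lemma sum_exp_neg_abs_bounded:
  fixes a :: real
  assumes "a > 0"
  shows "\<exists>S>0. \<forall>u\<ge>0. \<forall>M. (\<Sum>k\<le>M. exp (- \<bar>real k * a - u\<bar> / 2)) \<le> S"
proof -
  define q where "q = exp (- a / 2)"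
  have q: "0 \<le> q" "q < 1" using assms by (auto simp: q_def)
  have qpow: "q ^ i = exp (- (real i * a) / 2)" for i
    by (simp add: q_def exp_of_nat_mult[symmetric])
  have "(\<Sum>k\<le>M. exp (- \<bar>real k * a - u\<bar> / 2)) \<le> 2 / (1 - q)" if u: "u \<ge> 0" for u M
  proof -
    define m where "m = nat \<lfloor>u / a\<rfloor>"
    have "real m \<le> u / a" "u / a < real m + 1"
      using u assms by (auto simp: m_def)
    then have m: "real m * a \<le> u" "u < (real m + 1) * a"
      using assms by (simp_all add: field_simps)
    define h where "h = (\<lambda>k. exp (- \<bar>real k * a - u\<bar> / 2))"
    have "(\<Sum>k\<le>M. h k) \<le> (\<Sum>k<Suc m + Suc M. h k)"
      by (intro sum_mono2) (auto simp: h_def)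
    also have "\<dots> = (\<Sum>k<Suc m. h k) + (\<Sum>k<Suc M. h (Suc m + k))"
      by (induction M) (auto simp: algebra_simps)
    \<comment> \<open>The exponent \<open>m - k\<close> is written \<open>Suc m - Suc k\<close> to
      match the reversal of the sum below.\<close>
    also have "(\<Sum>k<Suc m. h k) \<le> (\<Sum>k<Suc m. q ^ (Suc m - Suc k))"
    proof (rule sum_mono)
      fix k assume "k \<in> {..<Suc m}"
      then have k: "k \<le> m" by simp
      then have "real (m - k) * a \<le> u - real k * a" using m by (simp add: of_nat_diff algebra_simps)
      also have "\<dots> \<le> \<bar>real k * a - u\<bar>" by simp
      finally show "h k \<le> q ^ (Suc m - Suc k)" by (simp add: h_def qpow)
    qed
    also have "(\<Sum>k<Suc m. q ^ (Suc m - Suc k)) = (\<Sum>k<Suc m. q ^ k)"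
      by (rule sum.nat_diff_reindex)
    also have "\<dots> \<le> 1 / (1 - q)" by (rule sum_power_le[OF q])
    also have "(\<Sum>k<Suc M. h (Suc m + k)) \<le> (\<Sum>k<Suc M. q ^ k)"
    proof (rule sum_mono)
      fix k
      have "real k * a \<le> real (Suc m + k) * a - u" using m by (simp add: algebra_simps)
      also have "\<dots> \<le> \<bar>real (Suc m + k) * a - u\<bar>" by simp
      finally show "h (Suc m + k) \<le> q ^ k" by (simp add: h_def qpow)
    qed
    also have "\<dots> \<le> 1 / (1 - q)" by (rule sum_power_le[OF q])
    finally show ?thesis by (simp add: h_def)
  qed
  moreover have "2 / (1 - q) > 0" using q by simp
  ultimately show ?thesis by blast
qed

text \<open>With \<open>B i = exp (x i + s)\<close> and \<open>s = ln T / 2\<close>, the double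
  count becomes an exponential controlled by \<open>exponent_inequality\<close>. The decay in each
  size is retained for the later summation over sizes.\<close>

lemma card_presented_matrices_dyadic:
  assumes K: "K \<ge> 1" and r: "r < CARD('n::finite)"
  shows "\<exists>C>0. \<forall>(\<kappa>::nat \<Rightarrow> nat) T. T \<ge> 1 \<longrightarrow> (\<forall>i j. i \<le> j \<longrightarrow> j < r \<longrightarrow> \<kappa> i \<le> \<kappa> j) \<longrightarrow>
      (\<Prod>i<r. 2 ^ \<kappa> i)\<^sup>2 \<le> (K * T) ^ r \<longrightarrow>
      real (card (presented_matrices r (\<lambda>i. 2 ^ \<kappa> i) K T :: (int^'n^'n) set))
        \<le> C * T powr (real CARD('n) * real r / 2) * (\<Prod>i<r. exp (- \<bar>real (\<kappa> i) * ln 2 - ln T / 2\<bar> / 2))"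
proof -
  let ?n = "CARD('n)" and ?P = "index_pairs r"
  \<comment> \<open>The logarithm of the determinant bound, with \<open>r * s\<close> removed,
    bounds the sum of the \<open>x i\<close> by this value.\<close>
  define D where "D = real r * ln K / 2"
  define E where "E = 1 + 2 * real r ^ 2 * K"
  define H where "H = (3 * K * 2 ^ r) ^ ?n"
  define C where "C = H ^ r * E ^ card ?P * exp ((real ?n + 1) * D)"
  have E: "E \<ge> 1" using K by (simp add: E_def)
  have H: "H > 0" using K by (simp add: H_def)
  have D: "D \<ge> 0" using K by (simp add: D_def)
  have C: "C > 0" using E H by (simp add: C_def)
  have "real (card (presented_matrices r (\<lambda>i. 2 ^ \<kappa> i) K T :: (int^'n^'n) set))
        \<le> C * T powr (real ?n * real r / 2) * (\<Prod>i<r. exp (- \<bar>real (\<kappa> i) * ln 2 - ln T / 2\<bar> / 2))"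
    if T: "T \<ge> 1" and mono: "\<forall>i j. i \<le> j \<longrightarrow> j < r \<longrightarrow> \<kappa> i \<le> \<kappa> j"
      and det: "(\<Prod>i<r. 2 ^ \<kappa> i)\<^sup>2 \<le> (K * T) ^ r" for \<kappa> :: "nat \<Rightarrow> nat" and T
  proof -
    define B where "B = (\<lambda>i. (2::real) ^ \<kappa> i)"
    define s where "s = ln T / 2"
    define x where "x = (\<lambda>i. real (\<kappa> i) * ln 2 - s)"
    have B1: "B i \<ge> 1" for i by (simp add: B_def)
    have Bexp: "B i = exp (x i + s)" for i
      by (simp add: B_def x_def exp_of_nat_mult)
    have Texp: "T = exp (2 * s)" using T by (simp add: s_def)
    have xmono: "x i \<le> x j" if "i \<le> j" "j < r" for i j
      using mono that by (simp add: x_def)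
    have xsum: "(\<Sum>i<r. x i) \<le> D"
    proof -
      have "(\<Prod>i<r. B i)\<^sup>2 = exp (2 * (\<Sum>i<r. x i + s))"
        by (simp add: Bexp exp_sum[symmetric] exp_double)
      moreover have "(K * T) ^ r = exp (real r * (ln K + 2 * s))"
        using K by (simp add: exp_of_nat_mult exp_add Texp)
      ultimately have "2 * (\<Sum>i<r. x i + s) \<le> real r * (ln K + 2 * s)"
        using det by (simp add: B_def)
      then show ?thesis by (simp add: D_def sum.distrib algebra_simps)
    qed
    \<comment> \<open>Uses \<open>1 + c * y \<le> (1 + c) * max 1 y\<close> with
      \<open>E = 1 + c\<close>; the ratio \<open>B i / B j\<close> then moves into the
      maximum.\<close>
    have pair: "(1 + 2 * real r ^ 2 * K * T / (B i * B j)) * (B i / B j) \<le> E * exp (max (x i - x j) (- 2 * x j))" for i j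
    proof -
      have q: "T / (B i * B j) = exp (- x i - x j)"
        by (simp add: Bexp Texp exp_add[symmetric] exp_diff[symmetric])
      have ratio: "B i / B j = exp (x i - x j)"
        by (simp add: Bexp exp_diff[symmetric])
      let ?m = "max 1 (exp (- x i - x j))"
      have "1 + 2 * real r ^ 2 * K * (T / (B i * B j)) \<le> ?m + 2 * real r ^ 2 * K * ?m"
        unfolding q using K by (intro add_mono mult_left_mono) auto
      then have "1 + 2 * real r ^ 2 * K * T / (B i * B j) \<le> E * ?m"
        by (simp add: E_def algebra_simps)
      then have "(1 + 2 * real r ^ 2 * K * T / (B i * B j)) * (B i / B j) \<le> E * ?m * exp (x i - x j)"
        unfolding ratio by (intro mult_right_mono) auto
      also have "\<dots> = E * max (exp (x i - x j)) (exp (- x i - x j) * exp (x i - x j))"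
        by (simp add: max_mult_distrib_right mult.assoc)
      also have "\<dots> = E * max (exp (x i - x j)) (exp (- 2 * x j))"
        by (simp add: exp_add[symmetric])
      also have "\<dots> = E * exp (max (x i - x j) (- 2 * x j))"
        by (simp add: max_def)
      finally show ?thesis .
    qed
    let ?A = "presented_matrices r B K T :: (int^'n^'n) set"
    have inv: "(\<Prod>(i, j)\<in>?P. B j / B i) * (\<Prod>(i, j)\<in>?P. B i / B j) = 1"
      unfolding prod.distrib[symmetric]
      by (rule prod.neutral) (auto simp: B_def)
    have pos: "0 \<le> (\<Prod>(i, j)\<in>?P. B i / B j)" by (intro prod_nonneg) (auto simp: B_def)
    have "real (card ?A) = real (card ?A) * (\<Prod>(i, j)\<in>?P. B j / B i) * (\<Prod>(i, j)\<in>?P. B i / B j)"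
      using inv by (simp add: mult.assoc)
    also have "\<dots> \<le> (\<Prod>i<r. (3 * K * 2 ^ r * B i) ^ ?n) *
         (\<Prod>(i, j)\<in>?P. 1 + 2 * real r ^ 2 * K * T / (B i * B j)) * (\<Prod>(i, j)\<in>?P. B i / B j)"
      using B1 K T pos by (intro mult_right_mono card_presented_matrices) auto
    also have "\<dots> = (\<Prod>i<r. (3 * K * 2 ^ r * B i) ^ ?n) *
         (\<Prod>(i, j)\<in>?P. (1 + 2 * real r ^ 2 * K * T / (B i * B j)) * (B i / B j))"
      unfolding mult.assoc prod.distrib[symmetric] by (simp add: case_prod_unfold)
    also have "\<dots> \<le> (\<Prod>i<r. (3 * K * 2 ^ r * B i) ^ ?n) *
         (\<Prod>(i, j)\<in>?P. E * exp (max (x i - x j) (- 2 * x j)))"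
    proof (rule mult_left_mono)
      show "(\<Prod>(i, j)\<in>?P. (1 + 2 * real r ^ 2 * K * T / (B i * B j)) * (B i / B j))
          \<le> (\<Prod>(i, j)\<in>?P. E * exp (max (x i - x j) (- 2 * x j)))"
      proof (intro prod_mono, clarify)
        fix i j
        have "0 \<le> (1 + 2 * real r ^ 2 * K * T / (B i * B j)) * (B i / B j)"
          using K T B1[of i] B1[of j] by (intro mult_nonneg_nonneg add_nonneg_nonneg divide_nonneg_nonneg) auto
        then show "0 \<le> (1 + 2 * real r ^ 2 * K * T / (B i * B j)) * (B i / B j) \<and>
            (1 + 2 * real r ^ 2 * K * T / (B i * B j)) * (B i / B j) \<le> E * exp (max (x i - x j) (- 2 * x j))"
          using pair by blast
      qed
      show "0 \<le> (\<Prod>i<r. (3 * K * 2 ^ r * B i) ^ ?n)"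
        using K by (intro prod_nonneg) (auto simp: B_def)
    qed
    also have "(\<Prod>i<r. (3 * K * 2 ^ r * B i) ^ ?n) = H ^ r * exp (real ?n * (\<Sum>i<r. x i) + real ?n * real r * s)"
    proof -
      have "(\<Prod>i<r. (3 * K * 2 ^ r * B i) ^ ?n) = (\<Prod>i<r. H * exp (real ?n * (x i + s)))"
        by (intro prod.cong refl) (simp add: power_mult_distrib H_def Bexp exp_of_nat_mult)
      also have "\<dots> = H ^ r * exp (\<Sum>i<r. real ?n * (x i + s))"
        by (simp add: prod.distrib exp_sum)
      also have "(\<Sum>i<r. real ?n * (x i + s)) = real ?n * (\<Sum>i<r. x i) + real ?n * real r * s"
        unfolding sum_distrib_left[symmetric] by (simp add: sum.distrib algebra_simps)
      finally show ?thesis .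
    qed
    also have "(\<Prod>(i, j)\<in>?P. E * exp (max (x i - x j) (- 2 * x j)))
        = E ^ card ?P * exp (\<Sum>(i, j)\<in>?P. max (x i - x j) (- 2 * x j))"
      by (simp add: case_prod_unfold prod.distrib exp_sum)
    also have "H ^ r * exp (real ?n * (\<Sum>i<r. x i) + real ?n * real r * s) *
        (E ^ card ?P * exp (\<Sum>(i, j)\<in>?P. max (x i - x j) (- 2 * x j)))
      = H ^ r * E ^ card ?P * exp (real ?n * real r * s) *
        exp (real ?n * (\<Sum>i<r. x i) + (\<Sum>(i, j)\<in>?P. max (x i - x j) (- 2 * x j)))"
      by (simp add: exp_add)
    also have "\<dots> \<le> H ^ r * E ^ card ?P * exp (real ?n * real r * s) *
        exp ((real ?n + 1) * D - (\<Sum>i<r. \<bar>x i\<bar>) / 2)"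
      using exponent_inequality[OF xmono xsum D r] E H by (intro mult_left_mono) auto
    also have "\<dots> = C * exp (real ?n * real r * s) * exp (\<Sum>i<r. - \<bar>x i\<bar> / 2)"
    proof -
      have "(\<Sum>i<r. - \<bar>x i\<bar> / 2) = - ((\<Sum>i<r. \<bar>x i\<bar>) / 2)"
        by (simp add: sum_negf sum_divide_distrib)
      then have "exp ((real ?n + 1) * D - (\<Sum>i<r. \<bar>x i\<bar>) / 2)
          = exp ((real ?n + 1) * D) * exp (\<Sum>i<r. - \<bar>x i\<bar> / 2)"
        by (simp only: exp_add[symmetric] diff_conv_add_uminus)
      then show ?thesis by (simp add: C_def)
    qed
    also have "exp (real ?n * real r * s) = T powr (real ?n * real r / 2)"
      using T by (simp add: powr_def s_def)
    also have "exp (\<Sum>i<r. - \<bar>x i\<bar> / 2) = (\<Prod>i<r. exp (- \<bar>x i\<bar> / 2))" by (simp add: exp_sum)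
    finally show ?thesis by (simp add: x_def s_def B_def)
  qed
  then show ?thesis using C by (intro exI[of _ C]) blast
qed

section \<open>Covering by finitely many dyadic size vectors\<close>

lemma presented_matrices_cong:
  assumes "\<And>i. i < r \<Longrightarrow> B i = B' i"
  shows "presented_matrices r B K T = (presented_matrices r B' K T :: (int^'n^'n) set)"
proof -
  have "presentation r B K T A b c x = presentation r B' K T A b c x"
    for A :: "int^'n^'n" and b c x
    unfolding presentation_def using assms by auto
  then have "presentation r B K T = (presentation r B' K T :: int^'n^'n \<Rightarrow> _)"
    by (intro ext)
  then show ?thesis unfolding presented_matrices_def by simp
qed

text \<open>The sets for the admissible dyadic exponents cover all matrices in question. Each
  decaying factor depends on a single exponent, so the total is at most a product of
  \<open>r\<close> bounded sums.\<close>

lemma card_alt_matrices_rank_less_bound: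
  assumes r: "r < CARD('n::finite)"
  shows "\<exists>C>0. \<forall>T\<ge>1. real (card (alt_matrices_rank_less r T :: (int^'n^'n) set))
      \<le> C * T powr (real CARD('n) * real r / 2)"
proof -
  obtain K where K: "K \<ge> 1" and pres: "\<And>(A::int^'n^'n) T. alternating_matrix A \<Longrightarrow> frobenius_norm A < T \<Longrightarrow>
    (\<exists>\<kappa>::nat \<Rightarrow> nat.
      (\<forall>i j. i \<le> j \<longrightarrow> j < rank (map_matrix real_of_int A) \<longrightarrow> \<kappa> i \<le> \<kappa> j) \<and>
      A \<in> presented_matrices (rank (map_matrix real_of_int A)) (\<lambda>i. 2 ^ \<kappa> i) K T \<and>
      (\<Prod>i<rank (map_matrix real_of_int A). 2 ^ \<kappa> i)\<^sup>2 \<le> (K * T) ^ rank (map_matrix real_of_int A))"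
    using presentation_exists[where 'n = 'n] by blast
  obtain C where C: "C > 0" and dyadic: "\<And>(\<kappa>::nat \<Rightarrow> nat) T. T \<ge> 1 \<Longrightarrow> (\<forall>i j. i \<le> j \<longrightarrow> j < r \<longrightarrow> \<kappa> i \<le> \<kappa> j) \<Longrightarrow>
      (\<Prod>i<r. 2 ^ \<kappa> i)\<^sup>2 \<le> (K * T) ^ r \<Longrightarrow>
      real (card (presented_matrices r (\<lambda>i. 2 ^ \<kappa> i) K T :: (int^'n^'n) set))
        \<le> C * T powr (real CARD('n) * real r / 2) * (\<Prod>i<r. exp (- \<bar>real (\<kappa> i) * ln 2 - ln T / 2\<bar> / 2))"
    using card_presented_matrices_dyadic[where 'n = 'n, OF K r] by blast
  obtain S where S: "S > 0" and geo: "\<And>u M. u \<ge> 0 \<Longrightarrow> (\<Sum>k\<le>M. exp (- \<bar>real k * ln 2 - u\<bar> / 2)) \<le> S"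
    using sum_exp_neg_abs_bounded[of "ln 2"] by auto
  have "real (card (alt_matrices_rank_less r T :: (int^'n^'n) set))
      \<le> (C * S ^ r) * T powr (real CARD('n) * real r / 2)" if T: "T \<ge> 1" for T
  proof -
    \<comment> \<open>\<open>M\<close> makes the set of exponents finite. It may depend on
      \<open>T\<close>, since the bound \<open>geo\<close> is uniform in \<open>M\<close>.\<close>
    obtain M :: nat where M: "(K * T) ^ r < 2 ^ M" using real_arch_pow[of 2 "(K * T) ^ r"] by auto
    define g where "g = (\<lambda>k::nat. exp (- \<bar>real k * ln 2 - ln T / 2\<bar> / 2))"
    define \<Phi> where "\<Phi> = {\<kappa> \<in> PiE {..<r} (\<lambda>_. {..M}). (\<forall>i j. i \<le> j \<longrightarrow> j < r \<longrightarrow> \<kappa> i \<le> \<kappa> j) \<and>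
        (\<Prod>i<r. 2 ^ \<kappa> i)\<^sup>2 \<le> (K * T) ^ r}"
    let ?F = "\<lambda>\<kappa>. presented_matrices r (\<lambda>i. 2 ^ \<kappa> i) K T :: (int^'n^'n) set"
    have fin\<Phi>: "finite \<Phi>" unfolding \<Phi>_def by (intro finite_Collect_conjI) (auto intro: finite_PiE)
    have finF: "finite (?F \<kappa>)" for \<kappa> using K T by (intro card_presented_matrices) auto
    have "alt_matrices_rank_less r T \<subseteq> (\<Union>\<kappa>\<in>\<Phi>. ?F \<kappa>)"
    proof
      fix A :: "int^'n^'n" assume A: "A \<in> alt_matrices_rank_less r T"
      then obtain \<kappa> :: "nat \<Rightarrow> nat" where mono: "\<forall>i j. i \<le> j \<longrightarrow> j < r \<longrightarrow> \<kappa> i \<le> \<kappa> j"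
        and AF: "A \<in> ?F \<kappa>" and det: "(\<Prod>i<r. 2 ^ \<kappa> i)\<^sup>2 \<le> (K * T) ^ r"
        using pres[of A T] by (auto simp: alt_matrices_rank_less_def)
      have \<kappa>M: "\<kappa> i \<le> M" if "i < r" for i
      proof -
        have "(2::real) ^ \<kappa> i = (\<Prod>j\<in>{i}. 2 ^ \<kappa> j)" by simp
        also have "\<dots> \<le> (\<Prod>j<r. 2 ^ \<kappa> j)" using that by (intro prod_mono2) auto
        also have "\<dots> \<le> (\<Prod>j<r. 2 ^ \<kappa> j)\<^sup>2"
          by (rule self_le_power) (auto intro: prod_ge_1)
        also have "\<dots> < 2 ^ M" using det M by linarith
        finally have "\<kappa> i < M" by simp
        then show ?thesis by simp
      qed
      have "restrict \<kappa> {..<r} \<in> \<Phi>" using mono det \<kappa>M by (auto simp: \<Phi>_def)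
      \<comment> \<open>Restriction makes the exponent function a member of the finite product set
        without changing the matrices it presents.\<close>
      moreover have "?F (restrict \<kappa> {..<r}) = ?F \<kappa>" by (rule presented_matrices_cong) simp
      ultimately show "A \<in> (\<Union>\<kappa>\<in>\<Phi>. ?F \<kappa>)" using AF by blast
    qed
    then have "card (alt_matrices_rank_less r T :: (int^'n^'n) set) \<le> card (\<Union>\<kappa>\<in>\<Phi>. ?F \<kappa>)"
      using fin\<Phi> finF by (intro card_mono) auto
    also have "\<dots> \<le> (\<Sum>\<kappa>\<in>\<Phi>. card (?F \<kappa>))" by (rule card_UN_le[OF fin\<Phi>])
    finally have "real (card (alt_matrices_rank_less r T :: (int^'n^'n) set)) \<le> (\<Sum>\<kappa>\<in>\<Phi>. real (card (?F \<kappa>)))"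
      by (metis of_nat_mono of_nat_sum)
    also have "\<dots> \<le> (\<Sum>\<kappa>\<in>\<Phi>. C * T powr (real CARD('n) * real r / 2) * (\<Prod>i<r. g (\<kappa> i)))"
      unfolding g_def by (intro sum_mono dyadic T) (auto simp: \<Phi>_def)
    \<comment> \<open>Passing from \<open>\<Phi>\<close> to the full box allows the sum of products
      to factorise.\<close>
    also have "\<dots> \<le> (\<Sum>\<kappa>\<in>PiE {..<r} (\<lambda>_. {..M}). C * T powr (real CARD('n) * real r / 2) * (\<Prod>i<r. g (\<kappa> i)))"
    proof (rule sum_mono2)
      show "finite (PiE {..<r} (\<lambda>_. {..M}))" by (intro finite_PiE) auto
      show "\<Phi> \<subseteq> PiE {..<r} (\<lambda>_. {..M})" unfolding \<Phi>_def by blast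
      show "0 \<le> C * T powr (real CARD('n) * real r / 2) * (\<Prod>i<r. g (\<kappa> i))" for \<kappa>
        using C by (intro mult_nonneg_nonneg prod_nonneg) (auto simp: g_def)
    qed
    also have "\<dots> = C * T powr (real CARD('n) * real r / 2) * (\<Prod>i<r. \<Sum>k\<le>M. g k)"
      by (subst prod_sum_PiE) (simp_all add: sum_distrib_left)
    also have "\<dots> \<le> C * T powr (real CARD('n) * real r / 2) * (\<Prod>i<r. S)"
      unfolding g_def using C T by (intro mult_left_mono prod_mono conjI geo sum_nonneg) auto
    finally show ?thesis by (simp add: mult_ac)
  qed
  then show ?thesis using C S by (intro exI[of _ "C * S ^ r"]) auto
qed

theorem theorem9p4p5:
  shows "\<exists>C::real. C > 0 \<and>
    (\<forall>r::nat. even r \<and> r \<le> CARD('n::finite) - 1 \<longrightarrow>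
      (\<forall>\<^sub>F T::real in at_top.
        real (card (alt_matrices_rank_less r T :: (int^'n^'n) set))
          \<le> C * T powr (real CARD('n) * real r / 2)))"
proof -
  let ?N = "\<lambda>r T. real (card (alt_matrices_rank_less r T :: (int^'n^'n) set))"
  have "\<forall>r\<in>{..<CARD('n)}. \<exists>C>0. \<forall>T\<ge>1. ?N r T \<le> C * T powr (real CARD('n) * real r / 2)"
    using card_alt_matrices_rank_less_bound[where 'n = 'n] by blast
  then obtain C where C: "\<And>r. r < CARD('n) \<Longrightarrow> C r > 0"
    and bound: "\<And>r T. r < CARD('n) \<Longrightarrow> T \<ge> 1 \<Longrightarrow> ?N r T \<le> C r * T powr (real CARD('n) * real r / 2)"
    unfolding bchoice_iff by (metis lessThan_iff)
  \<comment> \<open>Summing over the finitely many ranks gives one constant that depends only on the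
    dimension.\<close>
  define C' where "C' = (\<Sum>r<CARD('n). C r)"
  have le: "C r \<le> C'" if "r < CARD('n)" for r
    unfolding C'_def using that C by (intro member_le_sum) (auto simp: less_imp_le)
  have "C' > 0" using le[of 0] C[of 0] by simp
  moreover have "\<forall>\<^sub>F T in at_top. ?N r T \<le> C' * T powr (real CARD('n) * real r / 2)"
    if "r \<le> CARD('n) - 1" for r
  proof -
    \<comment> \<open>The subtraction in the bound on \<open>r\<close> is on naturals; it is not
      truncated because \<open>'n\<close> is nonempty.\<close>
    have r: "r < CARD('n)" using that zero_less_card_finite[where 'a = 'n] by linarith
    have "?N r T \<le> C' * T powr (real CARD('n) * real r / 2)" if "T \<ge> 1" for T
      using bound[OF r that] mult_right_mono[OF le[OF r], of "T powr (real CARD('n) * real r / 2)"] by simp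
    then show ?thesis using eventually_ge_at_top[of 1] by (rule eventually_mono[rotated])
  qed
  ultimately show ?thesis by blast
qed

end
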